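(* Let $\mathbb{K}$ be a field and $R=\mathbb{K}[x_j\mid j\in\mathbb{N}]$ (the case $c=1$). For distinct monomials $x^a\neq x^b$ of $R$ let $A:=\{j\mid a_j\neq b_j\}$. The $\mathrm{Inc}(\mathbb{N})$-compatible monomial preorders on $R$ are exactly the trivial one, the following ones, and the inverses of the following ones: (1) $\prec^{\mathrm{d}}$: $x^a\prec^{\mathrm{d}}x^b$ iff $\deg(x^a)<\deg(x^b)$; (2) $\prec_{\mathrm{min}}$: $x^a\prec_{\mathrm{min}}x^b$ iff $a_{\min(A)}<b_{\min(A)}$; (3) $\prec^{\mathrm{d}}_{\mathrm{min}}$: $x^a\prec^{\mathrm{d}}_{\mathrm{min}}x^b$ iff $\deg(x^a)<\deg(x^b)$ or ($\deg(x^a)=\deg(x^b)$ and $a_{\min(A)}<b_{\min(A)}$); (4) $\prec^{\mathrm{rd}}_{\mathrm{min}}$: $x^a\prec^{\mathrm{rd}}_{\mathrm{min}}x^b$ iff $\deg(x^a)>\deg(x^b)$ or ($\deg(x^a)=\deg(x^b)$ and $a_{\min(A)}<b_{\min(A)}$); (5) $\prec_{\mathrm{max},i}$ for $i\in\mathbb{N}$: $x^a\prec_{\mathrm{max},i}x^b$ iff $\max(A)\ge i$ and $a_{\max(A)}<b_{\max(A)}$; (6) $\prec^{\mathrm{d}}_{\mathrm{max},i}$ for $i\in\mathbb{N}$: $x^a\prec^{\mathrm{d}}_{\mathrm{max},i}x^b$ iff $\deg(x^a)<\deg(x^b)$ or ($\deg(x^a)=\deg(x^b)$, $\max(A)\ge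 i$ and $a_{\max(A)}<b_{\max(A)}$); (7) $\prec^{\mathrm{rd}}_{\mathrm{max},i}$ for $i\in\mathbb{N}$: $x^a\prec^{\mathrm{rd}}_{\mathrm{max},i}x^b$ iff $\deg(x^a)>\deg(x^b)$ or ($\deg(x^a)=\deg(x^b)$, $\max(A)\ge i$ and $a_{\max(A)}<b_{\max(A)}$). In particular, there are only six $\mathrm{Inc}(\mathbb{N})$-compatible term orders on $R$, namely (given by their strict parts) $\prec_{\mathrm{min}}$, $\prec^{\mathrm{d}}_{\mathrm{min}}$, $(\prec^{\mathrm{rd}}_{\mathrm{min}})^{-1}$, $\prec_{\mathrm{max},1}$, $\prec^{\mathrm{d}}_{\mathrm{max},2}$, $(\prec^{\mathrm{rd}}_{\mathrm{max},2})^{-1}$.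
   Context: $\mathbb{N}=\{1,2,3,\dots\}$. Monomials of $R$ are written $x^a=\prod_j x_j^{a_j}$ with $a=(a_j)_{j\in\mathbb{N}}$ a finitely supported sequence of non-negative integers; $\deg(x^a)=\sum_j a_j$. (In (1)–(7), a monomial is never $\prec$ itself.) $\mathrm{Inc}(\mathbb{N})$ is the monoid of strictly increasing functions $p:\mathbb{N}\to\mathbb{N}$, acting on monomials by $p\cdot\prod_j x_j^{a_j}=\prod_j x_{p(j)}^{a_j}$. A monomial preorder on $R$ is a strict partial order $\prec$ on the monomials of $R$ that is multiplicative ($f\prec g\Rightarrow hf\prec hg$) and cancellative ($hf\prec hg\Rightarrow f\prec g$) for all monomials $f,g,h$, and for which incomparability (neither $f\prec g$ nor $g\prec f$) is transitive. It is $\mathrm{Inc}(\mathbb{N})$-compatible if $f\prec g\Rightarrow p\cdot f\prec p\cdot g$ for all monomials $f,g$ and all $p\in\mathrm{Inc}(\mathbb{N})$. It is trivial if every two monomials are incomparable. The inverse $\prec^{-1}$ is defined by $f\prec^{-1}g\Leftrightarrow g\prec f$. A term order on $R$ is a total order $\preceq$ on the monomials that respects multiplication and satisfies $1\preceq f$ for all monomials $f$; it is $\mathrm{Inc}(\mathbb{N})$-compatible if $f\preceq g\Rightarrow p\cdot f\preceq p\cdot g$ for all monomials $f,g$ and $p\in\mathrm{Inc}(\mathbb{N})$. It is identified with its strict part. *)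

theory Defs
  imports Main "HOL-Library.Poly_Mapping"
begin

text \<open>
  The index set of the variables is \<open>{1, 2, 3, \<dots>}\<close>, rendered by the library type \<^typ>\<open>num\<close> of
  strictly positive natural numbers with its usual linear order; \<open>num.One\<close> is 1 and
  \<open>num.Bit0 num.One\<close> is 2.
\<close>

type_synonym expo = "num \<Rightarrow>\<^sub>0 nat"

type_synonym 'k polyring = "expo \<Rightarrow>\<^sub>0 'k"

definition var :: "num \<Rightarrow> 'k::field polyring" where
  "var j = Poly_Mapping.single (Poly_Mapping.single j 1) 1"

definition xmon :: "expo \<Rightarrow> 'k::field polyring" where
  "xmon a = (\<Prod>j\<in>Poly_Mapping.keys a. var j ^ Poly_Mapping.lookup a j)"

definition monomials :: "'k::field polyring set" where
  "monomials = range xmon"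

definition mdeg :: "expo \<Rightarrow> nat" where
  "mdeg a = (\<Sum>j\<in>Poly_Mapping.keys a. Poly_Mapping.lookup a j)"

text \<open>
  A strictly increasing \<open>p\<close> sends the monomial \<open>xmon a\<close> to \<open>inc_act p a\<close>. Taking the exponent
  sequence as argument is harmless because \<open>xmon\<close> is injective, see \<open>inj_xmon\<close> below.
\<close>

definition inc_act :: "(num \<Rightarrow> num) \<Rightarrow> expo \<Rightarrow> 'k::field polyring" where
  "inc_act p a = (\<Prod>j\<in>Poly_Mapping.keys a. var (p j) ^ Poly_Mapping.lookup a j)"

text \<open>
  Relations on monomials are sets of pairs contained in \<open>monomials \<times> monomials\<close>, so that they have
  no spurious behaviour on other ring elements.
\<close>

definition incomparable :: "'k::field polyring rel \<Rightarrow> 'k polyring \<Rightarrow> 'k polyring \<Rightarrow> bool" where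
  "incomparable r f g \<longleftrightarrow> (f, g) \<notin> r \<and> (g, f) \<notin> r"

definition monomial_preorder :: "'k::field polyring rel \<Rightarrow> bool" where
  "monomial_preorder r \<longleftrightarrow>
     r \<subseteq> monomials \<times> monomials \<and> irrefl r \<and> trans r \<and>
     (\<forall>f\<in>monomials. \<forall>g\<in>monomials. \<forall>h\<in>monomials. (f, g) \<in> r \<longrightarrow> (h * f, h * g) \<in> r) \<and>
     (\<forall>f\<in>monomials. \<forall>g\<in>monomials. \<forall>h\<in>monomials. (h * f, h * g) \<in> r \<longrightarrow> (f, g) \<in> r) \<and>
     (\<forall>f\<in>monomials. \<forall>g\<in>monomials. \<forall>h\<in>monomials.
        incomparable r f g \<longrightarrow> incomparable r g h \<longrightarrow> incomparable r f h)"

definition inc_compatible :: "'k::field polyring rel \<Rightarrow> bool" where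
  "inc_compatible r \<longleftrightarrow>
     (\<forall>p a b. strict_mono p \<longrightarrow> (xmon a, xmon b) \<in> r \<longrightarrow> (inc_act p a, inc_act p b) \<in> r)"

definition trivial_preorder :: "'k::field polyring rel \<Rightarrow> bool" where
  "trivial_preorder r \<longleftrightarrow> (\<forall>f\<in>monomials. \<forall>g\<in>monomials. incomparable r f g)"

definition term_order :: "'k::field polyring rel \<Rightarrow> bool" where
  "term_order r \<longleftrightarrow>
     linear_order_on monomials r \<and>
     (\<forall>f\<in>monomials. \<forall>g\<in>monomials. \<forall>h\<in>monomials. (f, g) \<in> r \<longrightarrow> (h * f, h * g) \<in> r) \<and>
     (\<forall>f\<in>monomials. (1, f) \<in> r)"

definition diff_set :: "expo \<Rightarrow> expo \<Rightarrow> num set" where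
  "diff_set a b = {j. Poly_Mapping.lookup a j \<noteq> Poly_Mapping.lookup b j}"

text \<open>
  The guard \<open>a \<noteq> b\<close> keeps \<open>Min\<close> and \<open>Max\<close> away from the empty set.
\<close>

definition less_at_min :: "expo \<Rightarrow> expo \<Rightarrow> bool" where
  "less_at_min a b \<longleftrightarrow> a \<noteq> b \<and>
     Poly_Mapping.lookup a (Min (diff_set a b)) < Poly_Mapping.lookup b (Min (diff_set a b))"

definition less_at_max :: "num \<Rightarrow> expo \<Rightarrow> expo \<Rightarrow> bool" where
  "less_at_max i a b \<longleftrightarrow> a \<noteq> b \<and> i \<le> Max (diff_set a b) \<and>
     Poly_Mapping.lookup a (Max (diff_set a b)) < Poly_Mapping.lookup b (Max (diff_set a b))"

definition prec_d :: "'k::field polyring rel" where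
  "prec_d = {(xmon a, xmon b) | a b. mdeg a < mdeg b}"

definition prec_min :: "'k::field polyring rel" where
  "prec_min = {(xmon a, xmon b) | a b. less_at_min a b}"

definition prec_d_min :: "'k::field polyring rel" where
  "prec_d_min = {(xmon a, xmon b) | a b.
     mdeg a < mdeg b \<or> (mdeg a = mdeg b \<and> less_at_min a b)}"

definition prec_rd_min :: "'k::field polyring rel" where
  "prec_rd_min = {(xmon a, xmon b) | a b.
     mdeg a > mdeg b \<or> (mdeg a = mdeg b \<and> less_at_min a b)}"

definition prec_max :: "num \<Rightarrow> 'k::field polyring rel" where
  "prec_max i = {(xmon a, xmon b) | a b. less_at_max i a b}"

definition prec_d_max :: "num \<Rightarrow> 'k::field polyring rel" where
  "prec_d_max i = {(xmon a, xmon b) | a b.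
     mdeg a < mdeg b \<or> (mdeg a = mdeg b \<and> less_at_max i a b)}"

definition prec_rd_max :: "num \<Rightarrow> 'k::field polyring rel" where
  "prec_rd_max i = {(xmon a, xmon b) | a b.
     mdeg a > mdeg b \<or> (mdeg a = mdeg b \<and> less_at_max i a b)}"

definition listed_preorders :: "'k::field polyring rel set" where
  "listed_preorders =
     {prec_d, prec_min, prec_d_min, prec_rd_min} \<union>
     range prec_max \<union> range prec_d_max \<union> range prec_rd_max"

lemma single_power:
  "Poly_Mapping.single (Poly_Mapping.single j 1) (1::'k::field) ^ n
     = Poly_Mapping.single (Poly_Mapping.single (j::num) (n::nat)) 1"
proof (induction n)
  case 0
  then show ?case by (simp flip: single_one)
next
  case (Suc n)
  then show ?case
    by (simp add: mult_single flip: single_add)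
qed

lemma prod_single:
  "finite A \<Longrightarrow> (\<Prod>j\<in>A. Poly_Mapping.single (f j) (1::'k::field))
     = Poly_Mapping.single (\<Sum>j\<in>A. f j :: expo) 1"
  by (induction A rule: finite_induct) (simp_all add: mult_single)

lemma xmon_eq_single: "xmon a = (Poly_Mapping.single a 1 :: 'k::field polyring)"
proof -
  have "(\<Sum>j\<in>Poly_Mapping.keys a. Poly_Mapping.single j (Poly_Mapping.lookup a j)) = a"
    by (rule poly_mapping_eqI)
      (auto simp: lookup_sum lookup_single when_def in_keys_iff)
  then show ?thesis
    unfolding xmon_def var_def by (simp add: single_power[unfolded One_nat_def] prod_single)
qed

lemma inj_xmon: "inj (xmon :: expo \<Rightarrow> 'k::field polyring)"
proof (rule injI)
  fix a b :: expo
  assume "xmon a = (xmon b :: 'k polyring)"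
  then have "Poly_Mapping.keys (Poly_Mapping.single a (1::'k))
    = Poly_Mapping.keys (Poly_Mapping.single b (1::'k))"
    by (simp add: xmon_eq_single)
  then show "a = b" by simp
qed

end

(*
  The exponent difference identifies a monomial preorder with the cone P of its positive elements
  in the group of finitely supported integer sequences; that group is realised as int poly, so that
  the total degree of v is poly v 1 and the largest index of v is its polynomial degree.

  Write e k for the basis vectors. Shift-invariance of P turns one comparison of initial basis
  vectors into the same comparison for all index patterns obtained by spreading the indices.
  Up to inversion the first e k that is not incomparable with 0 is positive. If one of e 0, e 1
  dominates every multiple of the other (or some e j is incomparable with 0), this propagates to all
  indices and P is lexicographic from the top or from the bottom. Otherwise all e k are commensurable
  and a ratio e 1 / e 0 other than 1 would, iterated along e 0, e 1, e 2, ..., grow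
  exponentially against a uniform bound; hence P contains all elements of positive degree. On the
  elements of degree zero the same dichotomy is run on the differences e k - e j.
*)
theory Submission
  imports Defs "HOL-Computational_Algebra.Polynomial"
begin

section \<open>Finitely supported integer sequences as polynomials\<close>

abbreviation unit_vec :: "nat \<Rightarrow> int poly" ("e") where
  "unit_vec k \<equiv> monom 1 k"

lemma coeff_of_int_mult [simp]: "coeff (of_int c * v) k = c * coeff v k" for v :: "int poly"
  by (simp add: of_int_poly)

lemma poly_1_eq_sum:
  fixes v :: "int poly"
  assumes "degree v \<le> n"
  shows "poly v 1 = (\<Sum>k\<le>n. coeff v k)"
  using assms unfolding poly_altdef
  by (intro sum.mono_neutral_cong_left) (auto simp: coeff_eq_0)

lemma sum_unit_vec:
  assumes "degree v \<le> n"
  shows "v = (\<Sum>k\<le>n. of_int (coeff v k) * e k)"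
  using assms by (intro poly_eqI) (auto simp: coeff_sum coeff_eq_0 if_distrib[of "(*) _"] cong: if_cong)

text \<open>Subtracting \<open>e m\<close> from every basis vector changes the expansion by
  \<open>poly v 1\<close> copies of \<open>e m\<close>, that is, by nothing. The base index
  \<open>m\<close> is free: both 0 and the successor of the lowest index of \<open>v\<close> serve
  later.\<close>

lemma sum_unit_vec_diff:
  assumes "degree v \<le> n" "poly v 1 = 0"
  shows "v = (\<Sum>k\<le>n. of_int (coeff v k) * (e k - e m))"
proof -
  have "(\<Sum>k\<le>n. of_int (coeff v k) * e m) = of_int (poly v 1) * e m"
    using assms(1) by (simp add: poly_1_eq_sum sum_distrib_right)
  then show ?thesis
    using sum_unit_vec[OF assms(1)] assms(2)
    by (simp add: right_diff_distrib sum_subtractf)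
qed

lemma exists_power_le_mult_power:
  fixes p q N :: int
  assumes "0 < q" "q < p"
  shows "\<exists>n\<ge>1. N * q ^ n \<le> p ^ n"
proof -
  define x where "x = real_of_int p / real_of_int q"
  have "x > 1" using assms by (simp add: x_def)
  then obtain n where n: "real_of_int N < x ^ n"
    using real_arch_pow by blast
  \<comment> \<open>The exponent found may be 0; its successor is at least 1.\<close>
  have "x ^ n \<le> x ^ Suc n" using \<open>x > 1\<close> by (intro power_increasing) auto
  with n have "real_of_int N \<le> x ^ Suc n" by linarith
  then have "real_of_int N * real_of_int q ^ Suc n \<le> real_of_int p ^ Suc n"
    using assms by (simp add: x_def power_divide pos_le_divide_eq)
  then have "N * q ^ Suc n \<le> p ^ Suc n"
    by (metis of_int_le_iff of_int_mult of_int_power)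
  then show ?thesis by (intro exI[of _ "Suc n"]) simp
qed

text \<open>The last three hypotheses say that neither the first index nor either gap shrinks,
  written without truncated subtraction.\<close>

lemma strict_mono_extend:
  fixes i j k i' j' k' :: nat
  assumes "i < j" "j < k" "i \<le> i'" "i' + j \<le> j' + i" "j' + k \<le> k' + j"
  obtains q :: "nat \<Rightarrow> nat" where "strict_mono q" "q i = i'" "q j = j'" "q k = k'"
proof
  \<comment> \<open>Each \<open>if\<close> adds the surplus of the first index or of one gap from
    its position onwards; nothing is taken away, so the map is strictly increasing.\<close>
  let ?q = "\<lambda>m. m + (if i \<le> m then i' - i else 0) + (if j \<le> m then (j' + i) - (i' + j) else 0)
     + (if k \<le> m then (k' + j) - (j' + k) else 0)"
  show "strict_mono ?q" by (auto simp: strict_mono_def)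
  show "?q i = i'" "?q j = j'" "?q k = k'" using assms by auto
qed

section \<open>Lexicographic positivity from the top and from the bottom\<close>

text \<open>Sequences supported below index \<open>i\<close> lie neither in this cone nor in its
  negative: they are incomparable with 0. Indices start at 0, so \<open>top_pos 0\<close> is the
  total lexicographic order from the top.\<close>

definition top_pos :: "nat \<Rightarrow> int poly \<Rightarrow> bool" where
  "top_pos i v \<longleftrightarrow> (\<exists>k\<ge>i. coeff v k > 0 \<and> (\<forall>j>k. coeff v j = 0))"

definition bottom_pos :: "int poly \<Rightarrow> bool" where
  "bottom_pos v \<longleftrightarrow> (\<exists>k. coeff v k > 0 \<and> (\<forall>j<k. coeff v j = 0))"

lemma top_pos_cases:
  obtains "top_pos i v" | "top_pos i (- v)" | "\<And>j. j \<ge> i \<Longrightarrow> coeff v j = 0"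
proof (cases "degree v \<ge> i \<and> v \<noteq> 0")
  case True
  then have "coeff v (degree v) \<noteq> 0" by simp
  then have "coeff v (degree v) > 0 \<or> coeff (- v) (degree v) > 0"
    by (simp only: coeff_minus) linarith
  then show ?thesis
    using True that(1,2) coeff_eq_0[of v] unfolding top_pos_def
    by (metis coeff_minus neg_equal_0_iff_equal)
next
  case False
  then show ?thesis using that(3)
    by (metis coeff_0 coeff_eq_0 le_degree linorder_not_le order.trans)
qed

lemma bottom_pos_cases:
  obtains "bottom_pos v" | "bottom_pos (- v)" | "v = 0"
proof (cases "v = 0")
  case False
  then obtain k where k: "coeff v k \<noteq> 0" "\<And>j. j < k \<Longrightarrow> coeff v j = 0"
    using exists_least_iff[of "\<lambda>k. coeff v k \<noteq> 0"] by (auto simp: poly_eq_iff)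
  then have "coeff v k > 0 \<or> coeff (- v) k > 0"
    by auto
  then show ?thesis
    using k that(1,2) unfolding bottom_pos_def by (metis coeff_minus neg_equal_0_iff_equal)
qed (use that in auto)

section \<open>Positive cones\<close>

text \<open>With \<open>\<not> P (- v)\<close> read as \<open>v \<ge> 0\<close>,
  \<open>add_nonneg\<close> combines transitivity of the strict order with transitivity of
  incomparability.\<close>

locale cone =
  fixes P :: "int poly \<Rightarrow> bool"
  assumes asym: "P v \<Longrightarrow> \<not> P (- v)"
    and add_nonneg: "P u \<Longrightarrow> \<not> P (- v) \<Longrightarrow> P (u + v)"
begin

lemma irrefl: "\<not> P 0"
  using asym[of 0] by auto

lemma add_pos: "P u \<Longrightarrow> P v \<Longrightarrow> P (u + v)"
  using add_nonneg asym by blast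

lemma nonneg_add: "\<not> P (- u) \<Longrightarrow> \<not> P (- v) \<Longrightarrow> \<not> P (- (u + v))"
  using add_nonneg[of "- (u + v)" v] by auto

lemma nonneg_sum: "(\<And>k. k \<in> A \<Longrightarrow> \<not> P (- f k)) \<Longrightarrow> \<not> P (- sum f A)"
proof (induction A rule: infinite_finite_induct)
  case (insert x F)
  then show ?case using nonneg_add[of "f x" "sum f F"] by simp
qed (simp_all add: irrefl)

lemma nonneg_scale:
  assumes "\<not> P (- u)" "0 \<le> n" shows "\<not> P (- (of_int n * u))"
proof -
  have "\<not> P (- (of_nat m * u))" for m
  proof (induction m)
    case (Suc m)
    then show ?case using nonneg_add[OF assms(1) Suc] by (simp add: algebra_simps)
  qed (simp add: irrefl)
  then show ?thesis using assms(2) by (metis of_int_of_nat_eq zero_le_imp_eq_int)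
qed

lemma pos_scale:
  assumes "P u" "0 < n" shows "P (of_int n * u)"
proof -
  have "P (u + of_int (n - 1) * u)"
    using assms by (intro add_nonneg nonneg_scale asym) auto
  then show ?thesis by (simp add: algebra_simps)
qed

lemma scale_cancel: "P (of_int n * u) \<Longrightarrow> 0 < n \<Longrightarrow> P u"
  using nonneg_scale[of "- u" n] by auto

lemma scale_pos_iff:
  assumes "P u" shows "P (of_int n * u) \<longleftrightarrow> 0 < n"
  using pos_scale[OF assms] nonneg_scale[OF asym, of u "- n"] assms
  by (metis asym linorder_not_less minus_mult_left minus_minus neg_0_le_iff_le of_int_minus nonneg_scale)

text \<open>If \<open>P v\<close> held without \<open>Q v\<close>, the second hypothesis would give
  \<open>Q (- v)\<close>, hence \<open>P (- v)\<close>, against \<open>asym\<close>.\<close>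

lemma eq_coneI:
  assumes "\<And>v. Q v \<Longrightarrow> P v" "\<And>v. Q v \<or> Q (- v) \<or> \<not> P v"
  shows "P v = Q v"
  using assms asym by (metis)

section \<open>Domination and leading terms\<close>

text \<open>\<open>u\<close> is infinitely large compared with \<open>w\<close>: as \<open>n\<close>
  runs over all integers, \<open>u\<close> exceeds every multiple of \<open>w\<close> of either
  sign.\<close>

definition dominates :: "int poly \<Rightarrow> int poly \<Rightarrow> bool" where
  "dominates u w \<longleftrightarrow> (\<forall>n. P (u + of_int n * w))"

lemma domD: "dominates u w \<Longrightarrow> P (u + of_int n * w)"
  by (simp add: dominates_def)

lemma dom_pos: "dominates u w \<Longrightarrow> P u"
  using domD[of u w 0] by simp

lemma dom_add:
  assumes "dominates u w" "dominates u w'" shows "dominates u (w + w')"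
  unfolding dominates_def
proof
  fix n
  \<comment> \<open>Both multiples use \<open>2 * n\<close>, so the sum is twice the required
    element and the factor 2 can be cancelled.\<close>
  have "P ((u + of_int (2 * n) * w) + (u + of_int (2 * n) * w'))"
    by (intro add_pos domD assms)
  also have "(u + of_int (2 * n) * w) + (u + of_int (2 * n) * w') = of_int 2 * (u + of_int n * (w + w'))"
    by (simp add: algebra_simps)
  finally show "P (u + of_int n * (w + w'))" by (rule scale_cancel) simp
qed

lemma dom_0: "P u \<Longrightarrow> dominates u 0"
  by (simp add: dominates_def)

lemma dom_sum: "P u \<Longrightarrow> (\<And>k. k \<in> A \<Longrightarrow> dominates u (w k)) \<Longrightarrow> dominates u (sum w A)"
  by (induction A rule: infinite_finite_induct) (auto simp: dom_0 dom_add)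

lemma dom_scale_right:
  assumes "dominates u w" shows "dominates u (of_int c * w)"
  unfolding dominates_def
proof
  fix n show "P (u + of_int n * (of_int c * w))"
    using domD[OF assms, of "n * c"] by (simp add: mult.assoc)
qed

lemma dom_null:
  assumes "P u" "\<not> P w" "\<not> P (- w)" shows "dominates u w"
  unfolding dominates_def
proof
  fix n
  have "\<not> P (- (of_int n * w))"
    using assms nonneg_scale[of w n] nonneg_scale[of "- w" "- n"] by (cases "n \<ge> 0") auto
  then show "P (u + of_int n * w)"
    using assms(1) by (rule add_nonneg[rotated])
qed

lemma dom_scale_left:
  assumes "dominates u w" "0 < m" shows "dominates (of_int m * u) w"
  unfolding dominates_def
proof
  fix n
  have "P ((u + of_int n * w) + of_int (m - 1) * u)"
    using assms dom_pos[OF assms(1)] by (intro add_nonneg domD nonneg_scale asym) auto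
  then show "P (of_int m * u + of_int n * w)" by (simp add: algebra_simps)
qed

text \<open>Leading term argument shared by all lexicographic cases: the terms other than
  \<open>w k\<close> add up to an element dominated by \<open>c * u\<close>, so \<open>w k\<close>
  decides the sign.\<close>

lemma pos_sum_dominant:
  assumes "finite A" "k \<in> A" "P u" "0 < c" "w k = of_int c * u"
    "\<And>j. j \<in> A \<Longrightarrow> j \<noteq> k \<Longrightarrow> w j = 0 \<or> (\<exists>d x. w j = of_int d * x \<and> dominates u x)"
  shows "P (sum w A)"
proof -
  note u = assms(3)
  have "dominates u (w j)" if "j \<in> A - {k}" for j
    using assms(6)[of j] that dom_0[OF u] dom_scale_right by auto
  then have "dominates (of_int c * u) (sum w (A - {k}))"
    by (intro dom_scale_left dom_sum u \<open>0 < c\<close>)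
  then have "P (w k + of_int 1 * sum w (A - {k}))"
    unfolding assms(5) by (rule domD)
  then show ?thesis
    using assms(1,2) by (simp add: sum.remove)
qed

text \<open>Failure of domination at \<open>n\<close> makes \<open>- u - n * w\<close> non-negative;
  adding the positive \<open>w\<close> makes the inequality strict, with multiplier
  \<open>1 - n\<close>.\<close>

lemma not_dom:
  assumes "\<not> dominates u w" "P w" obtains n where "P (of_int n * w - u)"
proof -
  from assms obtain n where "\<not> P (u + of_int n * w)" by (auto simp: dominates_def)
  then have "\<not> P (- (- u - of_int n * w))" by (simp add: algebra_simps)
  from add_nonneg[OF assms(2) this] have "P (of_int (1 - n) * w - u)" by (simp add: algebra_simps)
  then show ?thesis by (rule that)
qed

section \<open>Exponential growth against a bound\<close>

text \<open>The step inequality is asked for only below \<open>n\<close>, so that the lemma also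
  applies to a finite segment read backwards.\<close>

lemma growth:
  assumes "\<And>k. k < n \<Longrightarrow> P (of_int q * u (Suc k) - of_int p * u k)" "0 < q" "q < p" "1 \<le> n"
  shows "P (of_int (q ^ n) * u n - of_int (p ^ n) * u 0)"
  using assms(4,1)
proof (induction n rule: nat_induct_at_least)
  case base
  then show ?case by simp
next
  case (Suc n)
  \<comment> \<open>Scaled by \<open>p\<close> and by \<open>q ^ n\<close>, the two inequalities
    share the term \<open>p * q ^ n * u n\<close>, which cancels.\<close>
  have "P (of_int p * (of_int (q ^ n) * u n - of_int (p ^ n) * u 0)
      + of_int (q ^ n) * (of_int q * u (Suc n) - of_int p * u n))"
    using assms(2,3) by (intro add_pos pos_scale Suc) auto
  then show ?case by (simp add: algebra_simps)
qed

text \<open>The steps force \<open>u n\<close> above \<open>(p / q) ^ n * u 0\<close>, the bound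
  keeps it below \<open>N * u 0\<close>; this is impossible once
  \<open>(p / q) ^ n \<ge> N\<close>.\<close>

lemma growth_bounded:
  assumes "\<And>k. P (of_int q * u (Suc k) - of_int p * u k)" "0 < q" "q < p"
    "\<And>k. 1 \<le> k \<Longrightarrow> P (of_int N * u 0 - u k)" "P (u 0)"
  shows False
proof -
  obtain n where n: "1 \<le> n" "N * q ^ n \<le> p ^ n"
    using exists_power_le_mult_power[OF assms(2,3)] by blast
  have "P ((of_int (q ^ n) * u n - of_int (p ^ n) * u 0) + of_int (q ^ n) * (of_int N * u 0 - u n))"
    using assms n by (intro add_pos pos_scale growth) auto
  also have "(of_int (q ^ n) * u n - of_int (p ^ n) * u 0) + of_int (q ^ n) * (of_int N * u 0 - u n)
      = of_int (N * q ^ n - p ^ n) * u 0"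
    by (simp add: algebra_simps)
  finally show False using n scale_pos_iff[OF assms(5), of "N * q ^ n - p ^ n"] by linarith
qed

lemma decay_bounded:
  assumes "\<And>k. P (of_int q * u k - of_int p * u (Suc k))" "0 < q" "q < p"
    "\<And>k. 1 \<le> k \<Longrightarrow> P (of_int N * u k - u 0)" "\<And>k. P (u k)"
  shows False
proof -
  obtain n where n: "1 \<le> n" "N * q ^ n \<le> p ^ n"
    using exists_power_le_mult_power[OF assms(2,3)] by blast
  \<comment> \<open>Read backwards from index \<open>n\<close>, the decreasing sequence
    grows.\<close>
  have "P (of_int (q ^ n) * u (n - n) - of_int (p ^ n) * u (n - 0))"
  proof (rule growth[of n q "\<lambda>k. u (n - k)" p])
    fix k assume "k < n"
    then show "P (of_int q * u (n - Suc k) - of_int p * u (n - k))"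
      using assms(1)[of "n - Suc k"] by (simp add: Suc_diff_Suc)
  qed (use assms n in auto)
  then have "P ((of_int (q ^ n) * u 0 - of_int (p ^ n) * u n) + of_int (q ^ n) * (of_int N * u n - u 0))"
    using assms n by (intro add_pos pos_scale) auto
  also have "(of_int (q ^ n) * u 0 - of_int (p ^ n) * u n) + of_int (q ^ n) * (of_int N * u n - u 0)
      = of_int (N * q ^ n - p ^ n) * u n"
    by (simp add: algebra_simps)
  finally show False using n scale_pos_iff[OF assms(5)[of n], of "N * q ^ n - p ^ n"] by linarith
qed

end


text \<open>In \<open>push\<close> the polynomial \<open>w\<close> is the image of \<open>v\<close> under the strictly increasing \<open>q\<close>.\<close>

locale inc_cone = cone +
  assumes push: "strict_mono q \<Longrightarrow> (\<And>k. coeff w (q k) = coeff v k) \<Longrightarrow>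
      (\<And>k. k \<notin> range q \<Longrightarrow> coeff w k = 0) \<Longrightarrow> P v \<Longrightarrow> P w"
begin

section \<open>Transporting comparisons to spread index patterns\<close>

text \<open>The map from \<open>strict_mono_extend\<close> carries one index triple to the other.
  Coefficients may be 0, so patterns of one or two indices are special cases.\<close>

lemma push3:
  assumes "i < j" "j < k" "i \<le> i'" "i' + j \<le> j' + i" "j' + k \<le> k' + j"
    and "P (of_int x * e i + of_int y * e j + of_int z * e k)"
  shows "P (of_int x * e i' + of_int y * e j' + of_int z * e k')"
proof -
  obtain q where q: "strict_mono q" "q i = i'" "q j = j'" "q k = k'"
    using strict_mono_extend assms(1-5) by metis
  have inj: "q m = q n \<longleftrightarrow> m = n" for m n
    using q(1) strict_mono_eq by blast
  show ?thesis
    unfolding q(2-4)[symmetric]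
    by (rule push[OF q(1) _ _ assms(6)]) (auto simp: inj)
qed

lemma push2:
  assumes "i < j" "i \<le> i'" "i' + j \<le> j' + i"
    and "P (of_int x * e i + of_int y * e j)"
  shows "P (of_int x * e i' + of_int y * e j')"
  using push3[of i j "Suc j" i' j' "Suc j'" x y 0] assms by simp

lemma push1:
  assumes "i \<le> i'" "P (e i)"
  shows "P (e i')"
  using push2[of i "Suc i" i' "Suc i'" 1 0] assms by simp

lemma dom_push2:
  assumes "i < j" "i \<le> i'" "i' + j \<le> j' + i"
  shows "dominates (e i) (e j) \<Longrightarrow> dominates (e i') (e j')" "dominates (e j) (e i) \<Longrightarrow> dominates (e j') (e i')"
  using push2[OF assms, of 1] push2[OF assms, of _ 1]
  by (auto simp: dominates_def add.commute)

lemma dom_diff_push3: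
  assumes "i < j" "j < k" "i \<le> i'" "i' + j \<le> j' + i" "j' + k \<le> k' + j"
  shows "dominates (e k - e i) (e j - e i) \<Longrightarrow> dominates (e k' - e i') (e j' - e i')"
    "dominates (e j - e i) (e k - e j) \<Longrightarrow> dominates (e j' - e i') (e k' - e j')"
proof -
  assume *: "dominates (e k - e i) (e j - e i)"
  have "P (e k' - e i' + of_int n * (e j' - e i'))" for n
    using push3[OF assms, of "- 1 - n" n 1] domD[OF *, of n] by (simp add: algebra_simps)
  then show "dominates (e k' - e i') (e j' - e i')" by (simp add: dominates_def)
next
  assume *: "dominates (e j - e i) (e k - e j)"
  have "P (e j' - e i' + of_int n * (e k' - e j'))" for n
    using push3[OF assms, of "- 1" "1 - n" n] domD[OF *, of n] by (simp add: algebra_simps)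
  then show "dominates (e j' - e i') (e k' - e j')" by (simp add: dominates_def)
qed

lemma null_sum:
  assumes "\<And>k. k \<in> A \<Longrightarrow> \<not> P (w k) \<and> \<not> P (- w k)"
  shows "\<not> P (\<Sum>k\<in>A. of_int (c k) * w k)"
proof -
  have "\<not> P (- (- (of_int (c k) * w k)))" if "k \<in> A" for k
    using assms[OF that] nonneg_scale[of "- w k" "c k"] nonneg_scale[of "w k" "- c k"]
    by (cases "c k \<ge> 0") auto
  then show ?thesis
    using nonneg_sum[of A "\<lambda>k. - (of_int (c k) * w k)"] by (simp add: sum_negf)
qed

section \<open>Recognising the lexicographic cones\<close>

text \<open>The highest nonzero coefficient at an index \<open>\<ge> i\<close> decides the sign. If
  there is none, \<open>v\<close> is a combination of basis vectors incomparable with 0.\<close>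

lemma eq_top_pos:
  assumes null: "\<And>k. k < i \<Longrightarrow> \<not> P (e k) \<and> \<not> P (- e k)"
    and dom: "\<And>k j. i \<le> k \<Longrightarrow> j < k \<Longrightarrow> dominates (e k) (e j)"
    and pos: "\<And>k. i \<le> k \<Longrightarrow> P (e k)"
  shows "P v = top_pos i v"
proof (rule eq_coneI)
  fix v assume "top_pos i v"
  then obtain k where k: "i \<le> k" "coeff v k > 0" "\<And>j. j > k \<Longrightarrow> coeff v j = 0"
    unfolding top_pos_def by auto
  have "P (\<Sum>j\<le>degree v. of_int (coeff v j) * e j)"
  proof (rule pos_sum_dominant[where k = k and u = "e k" and c = "coeff v k"])
    show "k \<in> {..degree v}" using k(2) le_degree[of v k] by simp
    fix j assume "j \<noteq> k"
    then show "of_int (coeff v j) * e j = 0 \<or> (\<exists>d x. of_int (coeff v j) * e j = of_int d * x \<and> dominates (e k) x)"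
      using k(3)[of j] dom[OF k(1), of j] by (cases "j < k") auto
  qed (use k pos in auto)
  then show "P v" by (simp flip: sum_unit_vec[OF order.refl])
next
  fix v
  show "top_pos i v \<or> top_pos i (- v) \<or> \<not> P v"
  proof (cases v rule: top_pos_cases[where i = i])
    case 3
    have "\<not> P (\<Sum>j<i. of_int (coeff v j) * e j)"
      using null by (intro null_sum) auto
    also have "(\<Sum>j<i. of_int (coeff v j) * e j) = v"
      using 3 by (intro poly_eqI) (auto simp: coeff_sum not_less if_distrib[of "(*) _"] cong: if_cong)
    finally show ?thesis by simp
  qed auto
qed

lemma eq_bottom_pos:
  assumes dom: "\<And>k j. k < j \<Longrightarrow> dominates (e k) (e j)"
    and pos: "\<And>k. P (e k)"
  shows "P v = bottom_pos v"
proof (rule eq_coneI)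
  fix v assume "bottom_pos v"
  then obtain k where k: "coeff v k > 0" "\<And>j. j < k \<Longrightarrow> coeff v j = 0"
    unfolding bottom_pos_def by auto
  have "P (\<Sum>j\<le>degree v. of_int (coeff v j) * e j)"
  proof (rule pos_sum_dominant[where k = k and u = "e k" and c = "coeff v k"])
    show "k \<in> {..degree v}" using k(1) le_degree[of v k] by simp
    fix j assume "j \<noteq> k"
    then show "of_int (coeff v j) * e j = 0 \<or> (\<exists>d x. of_int (coeff v j) * e j = of_int d * x \<and> dominates (e k) x)"
      using k(2)[of j] dom[of k j] by (cases "j > k") auto
  qed (use k pos in auto)
  then show "P v" by (simp flip: sum_unit_vec[OF order.refl])
next
  fix v
  show "bottom_pos v \<or> bottom_pos (- v) \<or> \<not> P v"
    by (cases v rule: bottom_pos_cases) (auto simp: irrefl)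
qed

section \<open>Cones decided by the total degree first\<close>

text \<open>All \<open>e k\<close> count as equally large up to infinitesimals; the elements of
  degree zero are left open.\<close>

definition proportional :: bool where
  "proportional \<longleftrightarrow> (\<forall>v. poly v 1 > 0 \<longrightarrow> P v)"

text \<open>If \<open>p * e 0 \<le> q * e 1\<close>, the ratio of consecutive basis vectors would be
  at least \<open>p / q > 1\<close> at every index, against the bound \<open>N\<close>. The
  symmetric failure gives geometric decay, against \<open>M\<close>.\<close>

lemma slopes_one:
  assumes pos: "\<And>k. P (e k)"
    and N: "P (of_int N * e 0 - e 1)" and M: "P (of_int M * e 1 - e 0)"
    and pq: "0 \<le> q" "q < p"
  shows "P (of_int p * e a - of_int q * e b)"
proof (cases "q = 0")
  case True
  then show ?thesis using pos_scale[OF pos] pq by simp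
next
  case False
  \<comment> \<open>Negating a strict inequality gives a weak one. Doubling it and adding one basis
    vector makes it strict again, with \<open>2 * q\<close> and \<open>2 * p - 1\<close> for
    \<open>q\<close> and \<open>p\<close>; the ratio stays above 1.\<close>
  have pq': "0 < 2 * q" "2 * q < 2 * p - 1" using False pq by auto
  have N': "P (of_int N * e a - e b)" if "a < b" for a b
    using push2[of 0 1 a b N "-1"] N that by (simp add: algebra_simps)
  have M': "P (of_int M * e b - e a)" if "a < b" for a b
    using push2[of 0 1 a b "-1" M] M that by (simp add: algebra_simps)
  have up: "P (of_int p * e 0 - of_int q * e 1)"
  proof (rule ccontr)
    assume "\<not> ?thesis"
    then have "\<not> P (- (of_int 2 * (of_int q * e 1 - of_int p * e 0)))"
      by (intro nonneg_scale) auto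
    from add_nonneg[OF pos this, of 0]
    have *: "P (of_int (- (2 * p - 1)) * e 0 + of_int (2 * q) * e 1)"
      by (simp add: algebra_simps)
    have "P (of_int (2 * q) * e (Suc k) - of_int (2 * p - 1) * e k)" for k
      using push2[OF _ _ _ *, of k "Suc k"] by (simp add: algebra_simps)
    from growth_bounded[of _ e, OF this pq' N' pos] show False by simp
  qed
  have down: "P (of_int p * e 1 - of_int q * e 0)"
  proof (rule ccontr)
    assume "\<not> ?thesis"
    then have "\<not> P (- (of_int 2 * (of_int q * e 0 - of_int p * e 1)))"
      by (intro nonneg_scale) auto
    from add_nonneg[OF pos this, of 1]
    have *: "P (of_int (2 * q) * e 0 + of_int (- (2 * p - 1)) * e 1)"
      by (simp add: algebra_simps)
    have "P (of_int (2 * q) * e k - of_int (2 * p - 1) * e (Suc k))" for k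
      using push2[OF _ _ _ *, of k "Suc k"] by (simp add: algebra_simps)
    from decay_bounded[of _ e, OF this pq' M' pos] show False by simp
  qed
  consider "a < b" | "b < a" | "a = b" by linarith
  then show ?thesis
  proof cases
    case 1
    then show ?thesis using push2[of 0 1 a b p "-q"] up by (simp add: algebra_simps)
  next
    case 2
    then show ?thesis using push2[of 0 1 b a "-q" p] down by (simp add: algebra_simps)
  next
    case 3
    then show ?thesis using pos_scale[OF pos, of "p - q" a] pq by (simp add: algebra_simps)
  qed
qed

text \<open>By \<open>slopes_one\<close>, \<open>K * e j\<close> differs from \<open>K * e 0\<close> by less than \<open>e 0\<close>, so \<open>K * v\<close> is at least
  \<open>(K * poly v 1 - L) * e 0\<close>, where \<open>L\<close> is the sum of the absolute values of the coefficients.\<close>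

lemma proportionalI:
  assumes pos: "\<And>k. P (e k)"
    and N: "P (of_int N * e 0 - e 1)" and M: "P (of_int M * e 1 - e 0)"
  shows proportional
  unfolding proportional_def
proof (intro allI impI)
  fix v :: "int poly" assume D: "poly v 1 > 0"
  define L where "L = (\<Sum>j\<le>degree v. \<bar>coeff v j\<bar>)"
  \<comment> \<open>\<open>K\<close> exceeds \<open>L\<close>, so \<open>K * poly v 1 - L\<close> is
    at least 1 when the degree is positive.\<close>
  define K where "K = L + 1"
  have "K \<ge> 1" unfolding K_def L_def by (simp add: sum_nonneg)
  note slopes = slopes_one[OF pos N M]
  define t where "t j = of_int K * (of_int (coeff v j) * e j) - of_int (K * coeff v j - \<bar>coeff v j\<bar>) * e 0" for j
  have "\<not> P (- t j)" for j
  proof (cases "coeff v j \<ge> 0")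
    case True
    have "P (of_int K * e j - of_int (K - 1) * e 0)" using \<open>K \<ge> 1\<close> by (intro slopes) auto
    from nonneg_scale[OF asym[OF this] True] show ?thesis
      using True by (simp add: t_def algebra_simps)
  next
    case False
    have "P (of_int (K + 1) * e 0 - of_int K * e j)" using \<open>K \<ge> 1\<close> by (intro slopes) auto
    from nonneg_scale[OF asym[OF this], of "- coeff v j"] show ?thesis
      using False by (simp add: t_def algebra_simps)
  qed
  then have *: "\<not> P (- sum t {..degree v})" by (rule nonneg_sum)
  have "sum t {..degree v} = (\<Sum>j\<le>degree v. of_int K * (of_int (coeff v j) * e j)) -
      (\<Sum>j\<le>degree v. of_int (K * coeff v j - \<bar>coeff v j\<bar>) * e 0)"
    unfolding t_def by (rule sum_subtractf)
  also have "\<dots> = of_int K * (\<Sum>j\<le>degree v. of_int (coeff v j) * e j) -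
      of_int (\<Sum>j\<le>degree v. K * coeff v j - \<bar>coeff v j\<bar>) * e 0"
    by (simp only: sum_distrib_left sum_distrib_right of_int_sum)
  also have "(\<Sum>j\<le>degree v. K * coeff v j - \<bar>coeff v j\<bar>) = K * poly v 1 - L"
    by (simp add: sum_subtractf L_def poly_1_eq_sum[OF order.refl] sum_distrib_left)
  finally have eq: "sum t {..degree v} = of_int K * v - of_int (K * poly v 1 - L) * e 0"
    by (simp flip: sum_unit_vec[OF order.refl])
  have "K * 1 \<le> K * poly v 1" using D \<open>K \<ge> 1\<close> by (intro mult_left_mono) auto
  then have "P (of_int (K * poly v 1 - L) * e 0)" by (intro pos_scale pos) (simp add: K_def)
  from add_nonneg[OF this *] have "P (of_int K * v)" unfolding eq by simp
  then show "P v" by (rule scale_cancel) (use \<open>K \<ge> 1\<close> in simp)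
qed

lemma classify_pos:
  assumes null: "\<And>k. k < i \<Longrightarrow> \<not> P (e k) \<and> \<not> P (- e k)" and "P (e i)"
  shows "P = top_pos i \<or> P = bottom_pos \<or> proportional"
proof (cases i)
  case (Suc m)
  have pos: "P (e k)" if "i \<le> k" for k using push1 that assms(2) by blast
  \<comment> \<open>The indices \<open>m\<close> and \<open>i\<close> are adjacent, so this one
    domination spreads to all pairs \<open>i \<le> j < k\<close>.\<close>
  have m: "dominates (e i) (e m)" using assms Suc by (intro dom_null) auto
  have "dominates (e k) (e j)" if "i \<le> k" "j < k" for k j
  proof (cases "j < i")
    case True
    then show ?thesis using null pos that by (intro dom_null) auto
  next
    case False
    then show ?thesis using dom_push2(2)[OF _ _ _ m] Suc that by auto
  qed
  then show ?thesis using eq_top_pos null pos by blast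
next
  case 0
  have pos: "P (e k)" for k using push1 0 assms(2) by blast
  consider "dominates (e 1) (e 0)" | "dominates (e 0) (e 1)" | "\<not> dominates (e 1) (e 0)" "\<not> dominates (e 0) (e 1)" by blast
  then show ?thesis
  proof cases
    case 1
    have "dominates (e k) (e j)" if "j < k" for k j
      using dom_push2(2)[OF _ _ _ 1] that by auto
    then show ?thesis using eq_top_pos[of i] null pos by blast
  next
    case 2
    have "dominates (e k) (e j)" if "k < j" for k j
      using dom_push2(1)[OF _ _ _ 2] that by auto
    then show ?thesis using eq_bottom_pos pos by blast
  next
    \<comment> \<open>Failure of domination in both directions supplies the constants
      \<open>N\<close> and \<open>M\<close> of \<open>proportionalI\<close>.\<close>
    case 3
    then show ?thesis using not_dom pos proportionalI by metis
  qed
qed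

section \<open>Elements of degree zero\<close>

text \<open>The leading term argument of \<open>eq_top_pos\<close>, run with the vectors
  \<open>e k - e 0\<close>, which span the elements of degree zero.\<close>

lemma eq_top_pos_degree_0:
  assumes null: "\<And>k j. k < i \<Longrightarrow> j < k \<Longrightarrow> \<not> P (e k - e j) \<and> \<not> P (- (e k - e j))"
    and dom: "\<And>k j. i \<le> k \<Longrightarrow> 0 < j \<Longrightarrow> j < k \<Longrightarrow> dominates (e k - e 0) (e j - e 0)"
    and pos: "\<And>k. i \<le> k \<Longrightarrow> P (e k - e 0)"
    and "poly v 1 = 0"
  shows "P v = top_pos i v"
proof -
  have top: "P v" if "top_pos i v" "poly v 1 = 0" for v
  proof -
    from that(1) obtain k where k: "i \<le> k" "coeff v k > 0" "\<And>j. j > k \<Longrightarrow> coeff v j = 0"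
      unfolding top_pos_def by auto
    have "P (\<Sum>j\<le>degree v. of_int (coeff v j) * (e j - e 0))"
    proof (rule pos_sum_dominant[where k = k and u = "e k - e 0" and c = "coeff v k"])
      show "k \<in> {..degree v}" using k(2) le_degree[of v k] by simp
      fix j assume "j \<noteq> k"
      then show "of_int (coeff v j) * (e j - e 0) = 0 \<or>
          (\<exists>d x. of_int (coeff v j) * (e j - e 0) = of_int d * x \<and> dominates (e k - e 0) x)"
        using k(3)[of j] dom[OF k(1), of j] by (cases "j < k"; cases "j = 0") auto
    qed (use k pos in auto)
    then show "P v" unfolding sum_unit_vec_diff[OF order.refl that(2), of 0, symmetric] .
  qed
  consider "top_pos i v" | "top_pos i (- v)" | "\<not> top_pos i v" "\<not> top_pos i (- v)" by blast
  then show ?thesis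
  proof cases
    case 1
    then show ?thesis using top assms by blast
  next
    case 2
    then have "P (- v)" "\<not> top_pos i v" using top[of "- v"] assms(4)
      by (auto simp: top_pos_def) (metis less_irrefl linorder_neqE_nat order.asym)
    then show ?thesis using asym by fastforce
  next
    case 3
    then have zero: "\<And>j. j \<ge> i \<Longrightarrow> coeff v j = 0" by (metis top_pos_cases)
    \<comment> \<open>The cut-off makes every vector incomparable with 0, as \<open>null_sum\<close>
      demands; the coefficients from \<open>i\<close> on vanish, so the sum is unchanged.\<close>
    have "\<not> P (\<Sum>j\<le>degree v. of_int (if j < i then coeff v j else 0) * (if j < i then e j - e 0 else 0))"
    proof (rule null_sum)
      fix j
      show "\<not> P (if j < i then e j - e 0 else 0) \<and> \<not> P (- (if j < i then e j - e 0 else 0))"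
        using null[of j 0] irrefl by (cases "j = 0") auto
    qed
    also have "(\<Sum>j\<le>degree v. of_int (if j < i then coeff v j else 0) * (if j < i then e j - e 0 else 0)) =
        (\<Sum>j\<le>degree v. of_int (coeff v j) * (e j - e 0))"
      using zero by (intro sum.cong) auto
    finally show ?thesis using 3(1) unfolding sum_unit_vec_diff[OF order.refl assms(4), of 0, symmetric] by simp
  qed
qed

text \<open>The sign is reversed because \<open>e j - e i\<close> is positive for
  \<open>i < j\<close>: a negative lowest coefficient makes \<open>v\<close> positive.\<close>

lemma eq_bottom_neg_degree_0:
  assumes dom: "\<And>i j k. i < j \<Longrightarrow> j < k \<Longrightarrow> dominates (e j - e i) (e k - e j)"
    and "poly v 1 = 0"
  shows "P v = bottom_pos (- v)"
proof -
  have bot: "P v" if "bottom_pos (- v)" "poly v 1 = 0" for v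
  proof -
    from that(1) obtain k where k: "coeff v k < 0" "\<And>j. j < k \<Longrightarrow> coeff v j = 0"
      unfolding bottom_pos_def by auto
    \<comment> \<open>With base point \<open>e (Suc k)\<close> the lowest term is a positive
      multiple of \<open>e (Suc k) - e k\<close>, which dominates every
      \<open>e j - e (Suc k)\<close> with \<open>j > Suc k\<close>.\<close>
    have "P (\<Sum>j\<le>degree v. of_int (coeff v j) * (e j - e (Suc k)))"
    proof (rule pos_sum_dominant[where k = k and u = "e (Suc k) - e k" and c = "- coeff v k"])
      show "k \<in> {..degree v}" using k(1) le_degree[of v k] by simp
      show "P (e (Suc k) - e k)" by (rule dom_pos[OF dom[of _ _ "k + 2"]]) auto
      fix j assume "j \<noteq> k"
      then consider "j < k" | "j = Suc k" | "j > Suc k" by linarith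
      then show "of_int (coeff v j) * (e j - e (Suc k)) = 0 \<or>
          (\<exists>d x. of_int (coeff v j) * (e j - e (Suc k)) = of_int d * x \<and> dominates (e (Suc k) - e k) x)"
        using k(2)[of j] dom[of k "Suc k" j] by cases auto
    qed (use k in \<open>auto simp: algebra_simps\<close>)
    then show "P v" unfolding sum_unit_vec_diff[OF order.refl that(2), of "Suc k", symmetric] .
  qed
  show ?thesis
  proof (cases v rule: bottom_pos_cases)
    case 1
    then have "P (- v)" "\<not> bottom_pos (- v)" using bot[of "- v"] assms(2)
      by (auto simp: bottom_pos_def) (metis less_irrefl linorder_neqE_nat order.asym)
    then show ?thesis using asym by fastforce
  next
    case 2
    then show ?thesis using bot assms by blast
  next
    case 3
    then show ?thesis by (simp add: irrefl bottom_pos_def)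
  qed
qed

text \<open>For \<open>i > 1\<close>, \<open>e i - e 0\<close> dominates the null difference
  \<open>e (i - 1) - e 0\<close>, which yields the order from the top. For \<open>i = 1\<close>,
  either \<open>e 2 - e 0\<close> dominates \<open>e 1 - e 0\<close>, with the same outcome, or all
  \<open>e k - e 0\<close> are bounded by a multiple of \<open>e 1 - e 0\<close>; then
  \<open>e 1 - e 0\<close> must dominate \<open>e 2 - e 1\<close>, and the order is read from the
  bottom.\<close>

lemma classify_degree_0_pos:
  assumes null: "\<And>k j. k < i \<Longrightarrow> j < k \<Longrightarrow> \<not> P (e k - e j) \<and> \<not> P (- (e k - e j))"
    and "a < i" "P (e i - e a)"
  shows "(\<forall>v. poly v 1 = 0 \<longrightarrow> P v = top_pos i v) \<or> (\<forall>v. poly v 1 = 0 \<longrightarrow> P v = bottom_pos (- v))"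
proof -
  have base: "P (e i - e j)" if "j < i" for j
  proof -
    \<comment> \<open>Differences among indices below \<open>i\<close> are incomparable with 0, so
      \<open>e a\<close> can be traded for any such \<open>e j\<close>.\<close>
    have "\<not> P (- (e a - e j))"
      using null[of a j] null[of j a] irrefl assms(2) that by (cases a j rule: linorder_cases) auto
    from add_nonneg[OF assms(3) this] show ?thesis by simp
  qed
  then have pos: "P (e k - e j)" if "i \<le> k" "j < k" for k j
  proof (cases "j < i")
    case True
    then show ?thesis using push2[of j i j k "-1" 1] base that by simp
  next
    case False
    then show ?thesis using push2[of "i - 1" i j k "-1" 1] base[of "i - 1"] that \<open>a < i\<close> by simp
  qed
  have top: ?thesis if "\<And>k j. i \<le> k \<Longrightarrow> 0 < j \<Longrightarrow> j < k \<Longrightarrow> dominates (e k - e 0) (e j - e 0)"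
    using assms(2) by (intro disjI1 allI impI eq_top_pos_degree_0 null that pos) auto
  show ?thesis
  proof (cases "i = 1")
    case False
    then have "dominates (e i - e 0) (e (i - 1) - e 0)"
      using assms(2) null[of "i - 1" 0] pos[of i 0] by (intro dom_null) auto
    then have "dominates (e k - e 0) (e j - e 0)" if "i \<le> k" "0 < j" "j < k" for k j
    proof (cases "j < i")
      case True
      then show ?thesis using null[of j 0] pos[of k 0] that by (intro dom_null) auto
    next
      assume "\<not> j < i"
      then show ?thesis
        using False assms(2) that
        by (intro dom_diff_push3(1)[OF _ _ _ _ _ \<open>dominates (e i - e 0) (e (i - 1) - e 0)\<close>]) auto
    qed
    then show ?thesis by (rule top)
  next
    case i: True
    show ?thesis
    proof (cases "dominates (e 2 - e 0) (e 1 - e 0)")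
      case True
      have "dominates (e k - e 0) (e j - e 0)" if "0 < j" "j < k" for k j
        using that by (intro dom_diff_push3(1)[OF _ _ _ _ _ True]) auto
      then show ?thesis by (intro top)
    next
      case False
      then obtain N where "P (of_int N * (e 1 - e 0) - (e 2 - e 0))"
        using not_dom pos i by (metis One_nat_def le_refl zero_less_one)
      then have N: "P (of_int N * (e 1 - e 0) - (e k - e 0))" if "1 < k" for k
        using push3[of 0 1 2 0 1 k "1 - N" N "-1"] that by (simp add: algebra_simps)
      \<comment> \<open>A multiplier of at least 2 keeps the inequality strict at
        \<open>k = 1\<close> as well.\<close>
      have N1: "P (of_int (max N 2) * (e 1 - e 0) - (e k - e 0))" if "1 \<le> k" for k
      proof (cases "k = 1")
        case True
        then show ?thesis using pos_scale[OF pos[of 1 0], of "max N 2 - 1"] i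
          by (simp add: algebra_simps)
      next
        case False
        then have "P ((of_int N * (e 1 - e 0) - (e k - e 0)) + of_int (max N 2 - N) * (e 1 - e 0))"
          using that pos[of 1 0] i by (intro add_nonneg N nonneg_scale asym) auto
        then show ?thesis by (simp add: algebra_simps)
      qed
      have "dominates (e 1 - e 0) (e 2 - e 1)"
      proof (rule ccontr)
        assume "\<not> ?thesis"
        then obtain m where m: "P (of_int m * (e 2 - e 1) - (e 1 - e 0))"
          using not_dom pos[of 2 1] i by auto
        \<comment> \<open>Equivalently, \<open>m * (e (Suc k) - e 0)\<close> exceeds
          \<open>(m + 1) * (e k - e 0)\<close>: growth by the factor \<open>(m + 1) / m\<close>,
          against \<open>N1\<close>.\<close>
        have m': "P (of_int m * (e (Suc k) - e k) - (e k - e 0))" if "1 \<le> k" for k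
          using push3[of 0 1 2 0 k "Suc k" 1 "- m - 1" m] that m by (simp add: algebra_simps)
        have "P (of_int m * (e 2 - e 1))"
          using add_pos[OF m pos[of 1 0]] i by simp
        then have "m > 0" using scale_pos_iff[OF pos[of 2 1]] i by simp
        \<comment> \<open>The sequence starts at \<open>e 1 - e 0\<close>, since its first member
          must be positive and \<open>e 0 - e 0\<close> is zero.\<close>
        show False
        proof (rule growth_bounded[of m "\<lambda>k. e (Suc k) - e 0" "m + 1" "max N 2"])
          fix k
          show "P (of_int m * (e (Suc (Suc k)) - e 0) - of_int (m + 1) * (e (Suc k) - e 0))"
            using m'[of "Suc k"] by (simp add: algebra_simps)
        next
          fix k :: nat assume "1 \<le> k"
          then show "P (of_int (max N 2) * (e (Suc 0) - e 0) - (e (Suc k) - e 0))"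
            using N1[of "Suc k"] by simp
        qed (use \<open>m > 0\<close> pos[of 1 0] i in auto)
      qed
      then have "dominates (e b - e a) (e c - e b)" if "a < b" "b < c" for a b c
        using dom_diff_push3(2)[of 0 1 2 a b c] that by simp
      then show ?thesis using eq_bottom_neg_degree_0 by blast
    qed
  qed
qed

end

section \<open>Classification of the invariant cones\<close>

lemma inc_cone_uminus:
  assumes "inc_cone P" shows "inc_cone (\<lambda>v. P (- v))"
proof -
  interpret inc_cone P by fact
  show ?thesis
  proof unfold_locales
    fix v assume "P (- v)" then show "\<not> P (- (- v))" using asym by auto
  next
    fix u v assume "P (- u)" "\<not> P (- (- v))"
    then show "P (- (u + v))" using add_nonneg[of "- u" "- v"] by simp
  next
    fix q w v assume "strict_mono q" "\<And>k. coeff w (q k) = coeff v k"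
      "\<And>k. k \<notin> range q \<Longrightarrow> coeff w k = 0" "P (- v)"
    then show "P (- w)" using push[of q "- w" "- v"] by simp
  qed
qed

text \<open>With \<open>s = 1\<close> larger degree counts as larger, with \<open>s = - 1\<close>
  smaller degree does; \<open>Q\<close> breaks ties.\<close>

definition deg_then :: "int \<Rightarrow> (int poly \<Rightarrow> bool) \<Rightarrow> int poly \<Rightarrow> bool" where
  "deg_then s Q v \<longleftrightarrow> s * poly v 1 > 0 \<or> (poly v 1 = 0 \<and> Q v)"

definition listed_cones :: "(int poly \<Rightarrow> bool) set" where
  "listed_cones = {deg_then 1 (\<lambda>_. False), bottom_pos, deg_then 1 bottom_pos, deg_then (- 1) bottom_pos} \<union>
     range top_pos \<union> range (\<lambda>i. deg_then 1 (top_pos i)) \<union> range (\<lambda>i. deg_then (- 1) (top_pos i))"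

context inc_cone
begin

lemma eq_deg_then:
  assumes proportional "\<And>v. poly v 1 = 0 \<Longrightarrow> P v = Q v"
  shows "P = deg_then 1 Q"
proof
  fix v
  have "\<not> P v" if "poly v 1 < 0"
    using assms(1) that asym[of v] unfolding proportional_def by auto
  then show "P v = deg_then 1 Q v"
    using assms unfolding proportional_def deg_then_def by (cases "poly v 1" "0 :: int" rule: linorder_cases) auto
qed

text \<open>On degree zero either lexicographic order may occur with either sign. Negation flips the
  degree and the tie-break together, so the two reversed tie-breaks appear as inverses of the cones
  with \<open>s = - 1\<close>.\<close>

lemma classify_proportional:
  assumes proportional
  shows "P \<in> listed_cones \<or> (\<lambda>v. P (- v)) \<in> listed_cones"
proof (cases "\<forall>k j. j < k \<longrightarrow> \<not> P (e k - e j) \<and> \<not> P (- (e k - e j))")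
  case True
  have "\<not> P v" if "poly v 1 = 0" for v
  proof -
    have "\<not> P (\<Sum>j\<le>degree v. of_int (coeff v j) * (e j - e 0))"
    proof (rule null_sum)
      fix j show "\<not> P (e j - e 0) \<and> \<not> P (- (e j - e 0))"
        using True[rule_format, of 0 j] irrefl by (cases "j = 0") auto
    qed
    then show ?thesis unfolding sum_unit_vec_diff[OF order.refl that, of 0, symmetric] .
  qed
  then have "P = deg_then 1 (\<lambda>_. False)" using assms by (intro eq_deg_then) auto
  then show ?thesis by (simp add: listed_cones_def)
next
  case False
  interpret neg: inc_cone "\<lambda>v. P (- v)"
    by (intro inc_cone_uminus inc_cone_axioms)
  from False obtain i where i: "\<exists>a<i. P (e i - e a) \<or> P (- (e i - e a))"
    "\<And>k j. k < i \<Longrightarrow> j < k \<Longrightarrow> \<not> P (e k - e j) \<and> \<not> P (- (e k - e j))"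
    using exists_least_iff[of "\<lambda>k. \<exists>j<k. P (e k - e j) \<or> P (- (e k - e j))"] by blast
  then obtain a where a: "a < i" "P (e i - e a) \<or> P (- (e i - e a))" by blast
  have "(\<forall>v. poly v 1 = 0 \<longrightarrow> P v = top_pos i v) \<or> (\<forall>v. poly v 1 = 0 \<longrightarrow> P v = bottom_pos (- v)) \<or>
      (\<forall>v. poly v 1 = 0 \<longrightarrow> P (- v) = top_pos i v) \<or> (\<forall>v. poly v 1 = 0 \<longrightarrow> P (- v) = bottom_pos (- v))"
    using a(2)
  proof
    assume "P (e i - e a)"
    from classify_degree_0_pos[OF i(2) a(1) this] show ?thesis by blast
  next
    assume "P (- (e i - e a))"
    from neg.classify_degree_0_pos[OF _ a(1) this] i(2) show ?thesis by simp
  qed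
  then consider "\<And>v. poly v 1 = 0 \<Longrightarrow> P v = top_pos i v"
    | "\<And>v. poly v 1 = 0 \<Longrightarrow> P v = bottom_pos (- v)"
    | "\<And>v. poly v 1 = 0 \<Longrightarrow> P (- v) = top_pos i v"
    | "\<And>v. poly v 1 = 0 \<Longrightarrow> P (- v) = bottom_pos (- v)"
    by blast
  then show ?thesis
  proof cases
    case 1
    from eq_deg_then[OF assms this] show ?thesis by (simp add: listed_cones_def)
  next
    case 2
    from eq_deg_then[OF assms this] have "(\<lambda>v. P (- v)) = deg_then (- 1) bottom_pos"
      by (auto simp: deg_then_def fun_eq_iff)
    then show ?thesis by (simp add: listed_cones_def)
  next
    case 3
    have "P v = top_pos i (- v)" if "poly v 1 = 0" for v
      using 3[of "- v"] that by simp
    from eq_deg_then[OF assms this] have "(\<lambda>v. P (- v)) = deg_then (- 1) (top_pos i)"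
      by (auto simp: deg_then_def fun_eq_iff)
    then show ?thesis by (simp add: listed_cones_def)
  next
    case 4
    have "P v = bottom_pos v" if "poly v 1 = 0" for v
      using 4[of "- v"] that by simp
    from eq_deg_then[OF assms this] show ?thesis by (simp add: listed_cones_def)
  qed
qed

lemma classify_leading_pos:
  assumes "\<And>k. k < i \<Longrightarrow> \<not> P (e k) \<and> \<not> P (- e k)" "P (e i)"
  shows "P \<in> listed_cones \<or> (\<lambda>v. P (- v)) \<in> listed_cones"
  using classify_pos[OF assms] classify_proportional by (auto simp: listed_cones_def)

lemma classify: "P = (\<lambda>_. False) \<or> P \<in> listed_cones \<or> (\<lambda>v. P (- v)) \<in> listed_cones"
proof (cases "\<forall>k. \<not> P (e k) \<and> \<not> P (- e k)")
  case True
  have "\<not> P v" for v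
    using null_sum[of "{..degree v}" e "coeff v"] True by (simp flip: sum_unit_vec[OF order.refl])
  then show ?thesis by auto
next
  case False
  interpret neg: inc_cone "\<lambda>v. P (- v)"
    by (intro inc_cone_uminus inc_cone_axioms)
  from False obtain i where i: "P (e i) \<or> P (- e i)" "\<And>k. k < i \<Longrightarrow> \<not> P (e k) \<and> \<not> P (- e k)"
    using exists_least_iff[of "\<lambda>k. P (e k) \<or> P (- e k)"] by blast
  show ?thesis
    using i(1)
  proof
    assume "P (e i)"
    with classify_leading_pos[OF i(2)] show ?thesis by blast
  next
    assume "P (- e i)"
    with neg.classify_leading_pos[of i] i(2) show ?thesis by auto
  qed
qed

end

section \<open>The listed cones are invariant cones\<close>

lemma inc_cone_False: "inc_cone (\<lambda>_. False)"
  by unfold_locales auto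

lemma inc_cone_top_pos: "inc_cone (top_pos i)"
proof unfold_locales
  fix v assume "top_pos i v"
  then show "\<not> top_pos i (- v)"
    by (auto simp: top_pos_def) (metis less_irrefl linorder_neqE_nat order.asym)
next
  fix u v assume u: "top_pos i u" and v: "\<not> top_pos i (- v)"
  from u obtain k where k: "k \<ge> i" "coeff u k > 0" "\<And>j. j > k \<Longrightarrow> coeff u j = 0"
    by (auto simp: top_pos_def)
  show "top_pos i (u + v)"
  proof (cases v rule: top_pos_cases[where i = i])
    case 1
    then obtain l where l: "l \<ge> i" "coeff v l > 0" "\<And>j. j > l \<Longrightarrow> coeff v j = 0"
      by (auto simp: top_pos_def)
    have "coeff (u + v) (max k l) > 0"
      using k l by (cases k l rule: linorder_cases) (auto simp: max_def)
    then show ?thesis using k l unfolding top_pos_def by (intro exI[of _ "max k l"]) auto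
  next
    case 3
    then show ?thesis using k unfolding top_pos_def by (intro exI[of _ k]) auto
  qed (use v in auto)
next
  fix q w v assume q: "strict_mono q" "\<And>k. coeff w (q k) = coeff v k"
      "\<And>k. k \<notin> range q \<Longrightarrow> coeff w k = 0" and "top_pos i v"
  then obtain k where k: "k \<ge> i" "coeff v k > 0" "\<And>j. j > k \<Longrightarrow> coeff v j = 0"
    by (auto simp: top_pos_def)
  \<comment> \<open>A strictly increasing map never lowers an index, so the threshold
    \<open>i\<close> is respected.\<close>
  have "q k \<ge> i" using strict_mono_imp_increasing[OF q(1), of k] k(1) by linarith
  moreover have "coeff w j = 0" if "j > q k" for j
  proof (cases "j \<in> range q")
    case True
    then obtain m where "j = q m" by blast
    then show ?thesis using that q k(3)[of m] by (simp add: strict_mono_less)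
  qed (use q in auto)
  ultimately show "top_pos i w" using k q unfolding top_pos_def by (intro exI[of _ "q k"]) auto
qed

lemma inc_cone_bottom_pos: "inc_cone bottom_pos"
proof unfold_locales
  fix v assume "bottom_pos v"
  then show "\<not> bottom_pos (- v)"
    by (auto simp: bottom_pos_def) (metis less_irrefl linorder_neqE_nat order.asym)
next
  fix u v assume u: "bottom_pos u" and v: "\<not> bottom_pos (- v)"
  from u obtain k where k: "coeff u k > 0" "\<And>j. j < k \<Longrightarrow> coeff u j = 0"
    by (auto simp: bottom_pos_def)
  show "bottom_pos (u + v)"
  proof (cases v rule: bottom_pos_cases)
    case 1
    then obtain l where l: "coeff v l > 0" "\<And>j. j < l \<Longrightarrow> coeff v j = 0"
      by (auto simp: bottom_pos_def)
    have "coeff (u + v) (min k l) > 0"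
      using k l by (cases k l rule: linorder_cases) (auto simp: min_def)
    then show ?thesis using k l unfolding bottom_pos_def by (intro exI[of _ "min k l"]) auto
  qed (use u v in auto)
next
  fix q w v assume q: "strict_mono q" "\<And>k. coeff w (q k) = coeff v k"
      "\<And>k. k \<notin> range q \<Longrightarrow> coeff w k = 0" and "bottom_pos v"
  then obtain k where k: "coeff v k > 0" "\<And>j. j < k \<Longrightarrow> coeff v j = 0"
    by (auto simp: bottom_pos_def)
  have "coeff w j = 0" if "j < q k" for j
  proof (cases "j \<in> range q")
    case True
    then obtain m where "j = q m" by blast
    then show ?thesis using that q k(2)[of m] by (simp add: strict_mono_less)
  qed (use q in auto)
  then show "bottom_pos w" using k q unfolding bottom_pos_def by (intro exI[of _ "q k"]) auto
qed

text \<open>Written as a sum over the support, the degree is merely reindexed along the injective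
  \<open>q\<close>.\<close>

lemma poly_1_push:
  fixes v w :: "int poly"
  assumes "strict_mono q" "\<And>k. coeff w (q k) = coeff v k" "\<And>k. k \<notin> range q \<Longrightarrow> coeff w k = 0"
  shows "poly w 1 = poly v 1"
proof -
  have supp: "poly x 1 = (\<Sum>k | coeff x k \<noteq> 0. coeff x k)" for x :: "int poly"
    unfolding poly_1_eq_sum[OF order.refl]
    by (rule sum.mono_neutral_cong_right) (auto simp: le_degree)
  have "inj q" using assms(1) by (rule strict_mono_imp_inj_on)
  have "q ` {k. coeff v k \<noteq> 0} = {k. coeff w k \<noteq> 0}"
    using assms(2,3) by (auto simp: image_iff) (metis rangeE)
  then have "(\<Sum>k | coeff w k \<noteq> 0. coeff w k) = (\<Sum>k | coeff v k \<noteq> 0. coeff w (q k))"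
    using sum.reindex[OF inj_on_subset[OF \<open>inj q\<close> subset_UNIV], of "coeff w" "{k. coeff v k \<noteq> 0}"]
    by simp
  then show ?thesis using assms(2) by (simp add: supp)
qed

lemma inc_cone_deg_then:
  assumes "inc_cone Q" "s \<noteq> 0" shows "inc_cone (deg_then s Q)"
proof -
  interpret inc_cone Q by fact
  show ?thesis
  proof unfold_locales
    fix v assume "deg_then s Q v" then show "\<not> deg_then s Q (- v)"
      using asym by (auto simp: deg_then_def)
  next
    fix u v assume "deg_then s Q u" "\<not> deg_then s Q (- v)"
    then have u: "0 < s * poly u 1 \<or> poly u 1 = 0 \<and> Q u"
      and v: "0 < s * poly v 1 \<or> poly v 1 = 0 \<and> \<not> Q (- v)"
      using assms(2) by (auto simp: deg_then_def not_less le_less)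
    have "s * poly (u + v) 1 = s * poly u 1 + s * poly v 1" by (simp add: distrib_left)
    with u v show "deg_then s Q (u + v)"
      using add_nonneg[of u v] by (auto simp: deg_then_def)
  next
    fix q w v assume q: "strict_mono q" "\<And>k. coeff w (q k) = coeff v k"
      "\<And>k. k \<notin> range q \<Longrightarrow> coeff w k = 0" and "deg_then s Q v"
    then show "deg_then s Q w"
      using poly_1_push[OF q] push[OF q] by (auto simp: deg_then_def)
  qed
qed

lemma inc_cone_listed: "P \<in> listed_cones \<Longrightarrow> inc_cone P"
  by (auto simp: listed_cones_def inc_cone_False inc_cone_top_pos inc_cone_bottom_pos inc_cone_deg_then)

section \<open>Monomial relations as cones\<close>

text \<open>Passes from variables numbered from 1 to coefficients numbered from 0;
  \<open>num.One\<close> goes to 0.\<close>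

definition idx :: "num \<Rightarrow> nat" where
  "idx j = nat_of_num j - 1"

lemma idx_num_of_nat [simp]: "idx (num_of_nat (Suc k)) = k"
  by (simp add: idx_def num_of_nat_inverse del: num_of_nat.simps)

lemma nat_of_num_eq_idx: "nat_of_num j = Suc (idx j)"
  using nat_of_num_pos[of j] by (simp add: idx_def)

lemma idx_less_iff [simp]: "idx i < idx j \<longleftrightarrow> i < j"
  by (simp add: less_num_def nat_of_num_eq_idx)

lemma idx_le_iff [simp]: "idx i \<le> idx j \<longleftrightarrow> i \<le> j"
  by (simp add: less_eq_num_def nat_of_num_eq_idx)

lemma idx_eq_iff [simp]: "idx i = idx j \<longleftrightarrow> i = j"
  by (metis nat_of_num_eq_idx num_eq_iff)

lemma idx_surj: obtains j where "k = idx j"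
  using idx_num_of_nat by metis

lemma range_idx: "range idx = UNIV"
  using idx_surj by blast

section \<open>Exponent sequences inside the group\<close>

definition expo_poly :: "expo \<Rightarrow> int poly" where
  "expo_poly a = (\<Sum>j\<in>Poly_Mapping.keys a. monom (int (Poly_Mapping.lookup a j)) (idx j))"

lemma coeff_expo_poly [simp]: "coeff (expo_poly a) (idx j) = int (Poly_Mapping.lookup a j)"
  by (simp add: expo_poly_def coeff_sum in_keys_iff)

lemma int_poly_eqI: "(\<And>j. coeff u (idx j) = coeff v (idx j)) \<Longrightarrow> u = v" for u v :: "int poly"
  by (metis idx_surj poly_eqI)

lemma expo_poly_add [simp]: "expo_poly (a + b) = expo_poly a + expo_poly b"
  by (rule int_poly_eqI) (simp add: lookup_add)

lemma expo_poly_0 [simp]: "expo_poly 0 = 0"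
  by (simp add: expo_poly_def)

lemma expo_poly_sum: "expo_poly (sum f A) = (\<Sum>k\<in>A. expo_poly (f k))"
  by (induction A rule: infinite_finite_induct) simp_all

lemma expo_poly_eq_iff [simp]: "expo_poly a = expo_poly b \<longleftrightarrow> a = b"
  by (metis coeff_expo_poly of_nat_eq_iff poly_mapping_eqI)

lemma poly_expo_poly [simp]: "poly (expo_poly a) 1 = int (mdeg a)"
  by (simp add: expo_poly_def mdeg_def poly_sum poly_monom)

lemma expo_poly_single: "expo_poly (Poly_Mapping.single j n) = monom (int n) (idx j)"
  by (rule int_poly_eqI) (simp add: lookup_single when_def)

lemma expo_poly_diff_surj: obtains a b where "v = expo_poly b - expo_poly a"
proof -
  \<comment> \<open>\<open>nat\<close> truncates at 0, so \<open>g nat\<close> and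
    \<open>g (\<lambda>c. nat (- c))\<close> are the positive and negative parts of
    \<open>v\<close>.\<close>
  define g :: "(int \<Rightarrow> nat) \<Rightarrow> expo" where
    "g f = (\<Sum>k\<le>degree v. Poly_Mapping.single (num_of_nat (Suc k)) (f (coeff v k)))" for f
  have "expo_poly (g f) = (\<Sum>k\<le>degree v. monom (int (f (coeff v k))) k)" for f
    by (simp add: g_def expo_poly_sum expo_poly_single del: num_of_nat.simps)
  then have "expo_poly (g nat) - expo_poly (g (\<lambda>c. nat (- c))) =
      (\<Sum>k\<le>degree v. monom (int (nat (coeff v k)) - int (nat (- coeff v k))) k)"
    by (simp add: diff_monom flip: sum_subtractf)
  also have "\<dots> = (\<Sum>k\<le>degree v. monom (coeff v k) k)"
    by (intro sum.cong) auto
  also have "\<dots> = v" by (rule poly_as_sum_of_monoms)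
  finally show ?thesis using that by metis
qed

definition push_expo :: "(num \<Rightarrow> num) \<Rightarrow> expo \<Rightarrow> expo" where
  "push_expo p a = (\<Sum>j\<in>Poly_Mapping.keys a. Poly_Mapping.single (p j) (Poly_Mapping.lookup a j))"

lemma lookup_push_expo:
  assumes "strict_mono p"
  shows "Poly_Mapping.lookup (push_expo p a) (p j) = Poly_Mapping.lookup a j"
    and "k \<notin> range p \<Longrightarrow> Poly_Mapping.lookup (push_expo p a) k = 0"
  using strict_mono_eq[OF assms]
  by (auto simp: push_expo_def lookup_sum lookup_single when_def in_keys_iff)

lemma inc_act_eq: "inc_act p a = (xmon (push_expo p a) :: 'k::field polyring)"
  unfolding inc_act_def push_expo_def xmon_eq_single var_def
  by (simp add: single_power[unfolded One_nat_def] prod_single)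

lemma push_expo_eq_iff: "strict_mono p \<Longrightarrow> push_expo p a = push_expo p b \<longleftrightarrow> a = b"
  by (metis lookup_push_expo(1) poly_mapping_eqI)

lemma xmon_add: "xmon (a + b) = xmon a * (xmon b :: 'k::field polyring)"
  by (simp add: xmon_eq_single mult_single)

lemma xmon_eq_iff [simp]: "xmon a = (xmon b :: 'k::field polyring) \<longleftrightarrow> a = b"
  using inj_xmon by (auto dest: injD)

lemma xmon_neq_0 [simp]: "xmon a \<noteq> (0 :: 'k::field polyring)"
  by (metis keys_single keys_zero insert_not_empty one_neq_zero xmon_eq_single)

lemma xmon_0: "xmon 0 = (1 :: 'k::field polyring)"
  by (simp add: xmon_eq_single)

lemma xmon_in_monomials [simp]: "xmon a \<in> monomials"
  by (simp add: monomials_def)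

section \<open>Monomial preorders correspond to cones\<close>

definition cone_rel :: "(int poly \<Rightarrow> bool) \<Rightarrow> 'k::field polyring rel" where
  "cone_rel P = {(xmon a, xmon b) | a b. P (expo_poly b - expo_poly a)}"

lemma xmon_cone_rel_iff [simp]: "(xmon a, xmon b) \<in> cone_rel P \<longleftrightarrow> P (expo_poly b - expo_poly a)"
  by (auto simp: cone_rel_def)

lemma cone_rel_subset: "cone_rel P \<subseteq> monomials \<times> monomials"
  by (auto simp: cone_rel_def)

lemma monomials_rel_eqI:
  assumes "r \<subseteq> monomials \<times> monomials" "s \<subseteq> monomials \<times> monomials"
    and "\<And>a b. (xmon a, xmon b) \<in> r \<longleftrightarrow> (xmon a, xmon b) \<in> s"
  shows "r = s"
  using assms unfolding monomials_def by (auto; blast)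

lemma converse_cone_rel: "(cone_rel P)\<inverse> = cone_rel (\<lambda>v. P (- v))"
  by (auto simp: cone_rel_def)

lemma cone_rel_inject:
  assumes "cone_rel P = (cone_rel Q :: 'k::field polyring rel)" shows "P = Q"
proof
  fix v
  obtain a b where v: "v = expo_poly b - expo_poly a" by (rule expo_poly_diff_surj)
  have "(xmon a, xmon b) \<in> (cone_rel P :: 'k polyring rel) \<longleftrightarrow> (xmon a, xmon b) \<in> (cone_rel Q :: 'k polyring rel)"
    using assms by simp
  then show "P v = Q v" by (simp add: v)
qed

text \<open>A common factor leaves the exponent difference unchanged, which settles multiplicativity
  and cancellation. Transitivity of incomparability is closure of the elements incomparable with 0
  under addition.\<close>

lemma monomial_preorder_cone_rel:
  assumes "cone P" shows "monomial_preorder (cone_rel P)"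
proof -
  interpret cone P by fact
  have inc: "\<not> P (u + v)" if "\<not> P u" "\<not> P (- u)" "\<not> P v" "\<not> P (- v)" for u v
    using add_nonneg[of "u + v" "- v"] that by auto
  show ?thesis
    unfolding monomial_preorder_def
  proof (intro conjI)
    show "trans (cone_rel P)"
    proof (rule transI)
      fix f g h assume "(f, g) \<in> cone_rel P" "(g, h) \<in> cone_rel P"
      then show "(f, h) \<in> cone_rel P"
        using add_pos by (fastforce simp: cone_rel_def)
    qed
    show "\<forall>f\<in>monomials. \<forall>g\<in>monomials. \<forall>h\<in>monomials.
        incomparable (cone_rel P) f g \<longrightarrow> incomparable (cone_rel P) g h \<longrightarrow> incomparable (cone_rel P) f h"
    proof (unfold monomials_def, clarify)
      fix a b c
      assume "incomparable (cone_rel P) (xmon a) (xmon b)" "incomparable (cone_rel P) (xmon b) (xmon c)"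
      then show "incomparable (cone_rel P) (xmon a) (xmon c)"
        using inc[of "expo_poly b - expo_poly a" "expo_poly c - expo_poly b"]
          inc[of "expo_poly a - expo_poly b" "expo_poly b - expo_poly c"]
        by (auto simp: incomparable_def)
    qed
  qed (auto simp: cone_rel_subset irrefl_def cone_rel_def irrefl monomials_def simp flip: xmon_add)
qed

text \<open>Multiplicativity and cancellation together make membership in \<open>r\<close> depend on
  the exponent difference alone, so \<open>P\<close> does not depend on the chosen
  representatives.\<close>

lemma monomial_preorder_obtain_cone:
  fixes r :: "'k::field polyring rel"
  assumes "monomial_preorder r"
  obtains P where "cone P" "r = cone_rel P"
proof
  define P where "P v \<longleftrightarrow> (\<exists>a b. v = expo_poly b - expo_poly a \<and> (xmon a :: 'k polyring, xmon b) \<in> r)" for v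
  have sub: "r \<subseteq> monomials \<times> monomials"
    and irr: "\<And>f. (f, f) \<notin> r" and tr: "trans r"
    and mult: "\<And>a b c. (xmon a, xmon b) \<in> r \<Longrightarrow> (xmon (c + a), xmon (c + b)) \<in> r"
    using assms by (auto simp: monomial_preorder_def irrefl_def xmon_add)
  have canc: "(xmon a, xmon b) \<in> r" if "(xmon (c + a), xmon (c + b)) \<in> r" for a b c
    using assms that unfolding monomial_preorder_def xmon_add by (meson xmon_in_monomials)
  have inc: "incomparable r (xmon a) (xmon c)"
    if "incomparable r (xmon a) (xmon b)" "incomparable r (xmon b) (xmon c)" for a b c
    using assms that unfolding monomial_preorder_def by (meson xmon_in_monomials)
  have P_iff: "P (expo_poly b - expo_poly a) \<longleftrightarrow> (xmon a, xmon b) \<in> r" for a b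
  proof
    assume "P (expo_poly b - expo_poly a)"
    then obtain a' b' where "expo_poly b - expo_poly a = expo_poly b' - expo_poly a'"
      and *: "(xmon a', xmon b') \<in> r" by (auto simp: P_def)
    then have "expo_poly (b + a') = expo_poly (b' + a)" by (simp add: algebra_simps)
    then have "b + a' = b' + a" by (simp only: expo_poly_eq_iff)
    moreover have "(xmon (a + a'), xmon (a + b')) \<in> r" using mult * .
    ultimately have "(xmon (a' + a), xmon (a' + b)) \<in> r" by (simp add: add.commute)
    then show "(xmon a, xmon b) \<in> r" by (rule canc)
  qed (auto simp: P_def)
  show "r = cone_rel P"
    using sub cone_rel_subset by (rule monomials_rel_eqI) (simp add: P_iff)
  show "cone P"
  proof
    fix v assume "P v"
    then obtain a b where v: "v = expo_poly b - expo_poly a" by (auto simp: P_def)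
    have "- v = expo_poly a - expo_poly b" by (simp add: v)
    then show "\<not> P (- v)"
      using \<open>P v\<close> irr transD[OF tr] unfolding v by (metis P_iff)
  next
    fix u v assume uv: "P u" "\<not> P (- v)"
    obtain a b where u: "u = expo_poly b - expo_poly a" by (rule expo_poly_diff_surj)
    obtain c d where v: "v = expo_poly d - expo_poly c" by (rule expo_poly_diff_surj)
    \<comment> \<open>Both differences are rewritten with the common exponent \<open>b + c\<close>,
      so that they compose.\<close>
    have shift: "u = expo_poly (b + c) - expo_poly (a + c)" "- v = expo_poly (b + c) - expo_poly (b + d)"
      "u + v = expo_poly (b + d) - expo_poly (a + c)"
      by (simp_all add: u v)
    have ab: "(xmon (a + c), xmon (b + c)) \<in> r" and cd: "(xmon (b + d), xmon (b + c)) \<notin> r"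
      using uv unfolding shift P_iff by blast+
    have "(xmon (a + c), xmon (b + d)) \<in> r"
    proof (cases "(xmon (b + c), xmon (b + d)) \<in> r")
      case True
      then show ?thesis using transD[OF tr] ab by blast
    next
      case False
      show ?thesis
      proof (rule ccontr)
        assume "(xmon (a + c), xmon (b + d)) \<notin> r"
        \<comment> \<open>Otherwise transitivity with \<open>ab\<close> would contradict
          \<open>cd\<close>. Now both other monomials are incomparable with
          \<open>xmon (b + d)\<close>, hence with each other, against \<open>ab\<close>.\<close>
        moreover have "(xmon (b + d), xmon (a + c)) \<notin> r"
          using transD[OF tr _ ab] cd by blast
        ultimately have "incomparable r (xmon (a + c)) (xmon (b + c))"
          using False cd inc unfolding incomparable_def by blast
        then show False using ab by (simp add: incomparable_def)
      qed
    qed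
    then show "P (u + v)" unfolding shift(3) P_iff .
  qed
qed

lemma inc_compatible_cone_rel:
  assumes "inc_cone P" shows "inc_compatible (cone_rel P)"
  unfolding inc_compatible_def
proof (intro allI impI)
  interpret inc_cone P by fact
  fix p :: "num \<Rightarrow> num" and a b assume p: "strict_mono p" and "(xmon a, xmon b) \<in> cone_rel P"
  then have *: "P (expo_poly b - expo_poly a)" by simp
  \<comment> \<open>The action on variables, conjugated by \<open>idx\<close> to a map on
    coefficient indices.\<close>
  define q where "q = idx \<circ> p \<circ> (\<lambda>k. num_of_nat (Suc k))"
  have q: "q (idx j) = idx (p j)" for j
    unfolding q_def by (metis comp_apply idx_eq_iff idx_num_of_nat)
  have "P (expo_poly (push_expo p b) - expo_poly (push_expo p a))"
  proof (rule push[OF _ _ _ *])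
    show "strict_mono q"
    proof (rule strict_monoI)
      fix m n :: nat assume "m < n"
      moreover obtain i j where "m = idx i" "n = idx j" by (metis idx_surj)
      ultimately show "q m < q n" using p by (simp add: q strict_mono_less)
    qed
    fix k
    obtain j where k: "k = idx j" by (rule idx_surj)
    show "coeff (expo_poly (push_expo p b) - expo_poly (push_expo p a)) (q k) = coeff (expo_poly b - expo_poly a) k"
      using lookup_push_expo(1)[OF p] by (simp add: k q)
    assume "k \<notin> range q"
    then have "j \<notin> range p" using q k by (metis image_iff rangeI)
    then show "coeff (expo_poly (push_expo p b) - expo_poly (push_expo p a)) k = 0"
      using lookup_push_expo(2)[OF p] by (simp add: k)
  qed
  then show "(inc_act p a, inc_act p b) \<in> cone_rel P" by (simp add: inc_act_eq)
qed

lemma inc_compatible_cone_relD: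
  assumes "cone P" "inc_compatible (cone_rel P :: 'k::field polyring rel)" shows "inc_cone P"
proof -
  interpret cone P by fact
  show ?thesis
  proof unfold_locales
    fix q w v assume q: "strict_mono q" "\<And>k. coeff w (q k) = coeff v k"
      "\<And>k. k \<notin> range q \<Longrightarrow> coeff w k = 0" and "P v"
    obtain a b where v: "v = expo_poly b - expo_poly a" by (rule expo_poly_diff_surj)
    define p where "p = (\<lambda>k. num_of_nat (Suc k)) \<circ> q \<circ> idx"
    have p: "idx (p j) = q (idx j)" for j
      by (simp add: p_def del: num_of_nat.simps)
    have mono: "strict_mono p"
      using q(1) by (auto simp: strict_mono_def p simp flip: idx_less_iff)
    have "(inc_act p a :: 'k polyring, inc_act p b) \<in> cone_rel P"
      using assms(2) mono \<open>P v\<close> by (auto simp: inc_compatible_def v)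
    then have "P (expo_poly (push_expo p b) - expo_poly (push_expo p a))"
      by (simp add: inc_act_eq)
    also have "expo_poly (push_expo p b) - expo_poly (push_expo p a) = w"
    proof (rule int_poly_eqI)
      fix j
      show "coeff (expo_poly (push_expo p b) - expo_poly (push_expo p a)) (idx j) = coeff w (idx j)"
      proof (cases "j \<in> range p")
        case True
        then obtain i where "j = p i" by blast
        moreover have "coeff w (idx (p i)) = coeff v (idx i)" using q(2) by (simp add: p)
        ultimately show ?thesis using lookup_push_expo(1)[OF mono] by (simp add: v)
      next
        case False
        then have "idx j \<notin> range q" by (metis idx_eq_iff idx_surj image_iff p rangeI)
        then show ?thesis using q(3) False lookup_push_expo(2)[OF mono] by simp
      qed
    qed
    finally show "P w" .
  qed
qed

lemma cone_rel_iff_preorder: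
  "monomial_preorder r \<and> inc_compatible r \<longleftrightarrow> (\<exists>P. inc_cone P \<and> r = cone_rel P)"
proof safe
  assume "monomial_preorder r" "inc_compatible r"
  then show "\<exists>P. inc_cone P \<and> r = cone_rel P"
    by (metis monomial_preorder_obtain_cone inc_compatible_cone_relD)
qed (auto simp: monomial_preorder_cone_rel inc_compatible_cone_rel inc_cone.axioms(1))

section \<open>The listed preorders as cones\<close>

lemma diff_set_facts:
  assumes "a \<noteq> b" shows "finite (diff_set a b)" "diff_set a b \<noteq> {}"
proof -
  have "diff_set a b \<subseteq> Poly_Mapping.keys a \<union> Poly_Mapping.keys b"
    by (auto simp: diff_set_def in_keys_iff)
  then show "finite (diff_set a b)" by (rule finite_subset) simp
  show "diff_set a b \<noteq> {}" using assms by (auto simp: diff_set_def poly_mapping_eq_iff fun_eq_iff)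
qed

lemma less_at_max_iff: "less_at_max i a b \<longleftrightarrow> top_pos (idx i) (expo_poly b - expo_poly a)"
proof
  assume less: "less_at_max i a b"
  then have "a \<noteq> b" by (simp add: less_at_max_def)
  let ?m = "Max (diff_set a b)"
  have outside: "j \<notin> diff_set a b" if "j > ?m" for j
    using Max_ge[OF diff_set_facts(1)[OF \<open>a \<noteq> b\<close>], of j] that by (meson linorder_not_less)
  then have "coeff (expo_poly b - expo_poly a) k = 0" if "k > idx ?m" for k
  proof -
    obtain j where "k = idx j" by (rule idx_surj)
    then show ?thesis using that outside[of j] by (simp add: diff_set_def)
  qed
  then show "top_pos (idx i) (expo_poly b - expo_poly a)"
    using less unfolding top_pos_def less_at_max_def by (intro exI[of _ "idx ?m"]) auto
next
  assume "top_pos (idx i) (expo_poly b - expo_poly a)"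
  then obtain k where k: "k \<ge> idx i" "coeff (expo_poly b - expo_poly a) k > 0"
    "\<And>j. j > k \<Longrightarrow> coeff (expo_poly b - expo_poly a) j = 0"
    by (auto simp: top_pos_def)
  obtain m where m: "k = idx m" by (rule idx_surj)
  have "a \<noteq> b" using k(2) by auto
  moreover have "Max (diff_set a b) = m"
  proof (rule Max_eqI[OF diff_set_facts(1)[OF \<open>a \<noteq> b\<close>]])
    fix j assume "j \<in> diff_set a b"
    then show "j \<le> m" using k(3)[of "idx j"] by (auto simp: m diff_set_def simp flip: not_less)
  qed (use k(2) in \<open>auto simp: m diff_set_def\<close>)
  ultimately show "less_at_max i a b" using k by (simp add: m less_at_max_def)
qed

lemma less_at_min_iff: "less_at_min a b \<longleftrightarrow> bottom_pos (expo_poly b - expo_poly a)"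
proof
  assume less: "less_at_min a b"
  then have "a \<noteq> b" by (simp add: less_at_min_def)
  let ?m = "Min (diff_set a b)"
  have outside: "j \<notin> diff_set a b" if "j < ?m" for j
    using Min_le[OF diff_set_facts(1)[OF \<open>a \<noteq> b\<close>], of j] that by (meson linorder_not_less)
  then have "coeff (expo_poly b - expo_poly a) k = 0" if "k < idx ?m" for k
  proof -
    obtain j where "k = idx j" by (rule idx_surj)
    then show ?thesis using that outside[of j] by (simp add: diff_set_def)
  qed
  then show "bottom_pos (expo_poly b - expo_poly a)"
    using less unfolding bottom_pos_def less_at_min_def by (intro exI[of _ "idx ?m"]) auto
next
  assume "bottom_pos (expo_poly b - expo_poly a)"
  then obtain k where k: "coeff (expo_poly b - expo_poly a) k > 0"
    "\<And>j. j < k \<Longrightarrow> coeff (expo_poly b - expo_poly a) j = 0"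
    by (auto simp: bottom_pos_def)
  obtain m where m: "k = idx m" by (rule idx_surj)
  have "a \<noteq> b" using k(1) by auto
  moreover have "Min (diff_set a b) = m"
  proof (rule Min_eqI[OF diff_set_facts(1)[OF \<open>a \<noteq> b\<close>]])
    fix j assume "j \<in> diff_set a b"
    then show "m \<le> j" using k(2)[of "idx j"] by (auto simp: m diff_set_def simp flip: not_less)
  qed (use k(1) in \<open>auto simp: m diff_set_def\<close>)
  ultimately show "less_at_min a b" using k by (simp add: m less_at_min_def)
qed

lemma deg_then_expo_poly:
  "deg_then 1 Q (expo_poly b - expo_poly a) \<longleftrightarrow> mdeg a < mdeg b \<or> (mdeg a = mdeg b \<and> Q (expo_poly b - expo_poly a))"
  "deg_then (- 1) Q (expo_poly b - expo_poly a) \<longleftrightarrow> mdeg a > mdeg b \<or> (mdeg a = mdeg b \<and> Q (expo_poly b - expo_poly a))"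
  by (auto simp: deg_then_def)

lemma prec_eq_cone_rel:
  "prec_d = cone_rel (deg_then 1 (\<lambda>_. False))"
  "prec_min = cone_rel bottom_pos"
  "prec_d_min = cone_rel (deg_then 1 bottom_pos)"
  "prec_rd_min = cone_rel (deg_then (- 1) bottom_pos)"
  "prec_max i = cone_rel (top_pos (idx i))"
  "prec_d_max i = cone_rel (deg_then 1 (top_pos (idx i)))"
  "prec_rd_max i = cone_rel (deg_then (- 1) (top_pos (idx i)))"
  unfolding prec_d_def prec_min_def prec_d_min_def prec_rd_min_def prec_max_def prec_d_max_def
    prec_rd_max_def cone_rel_def deg_then_expo_poly less_at_min_iff less_at_max_iff
  by simp_all

lemma listed_preorders_eq: "listed_preorders = (cone_rel ` listed_cones :: 'k::field polyring rel set)"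
proof -
  \<comment> \<open>\<open>idx\<close> is onto, so a family indexed by \<open>num\<close> has the
    same members as the one indexed by \<open>nat\<close>.\<close>
  have range_eq: "range (\<lambda>i. cone_rel (Q (idx i))) = (cone_rel ` range Q :: 'k polyring rel set)"
    for Q :: "nat \<Rightarrow> int poly \<Rightarrow> bool"
    using image_image[of "\<lambda>k. cone_rel (Q k) :: 'k polyring rel" idx UNIV, symmetric]
    by (simp only: range_idx image_image[of cone_rel Q])
  show ?thesis
    unfolding listed_preorders_def listed_cones_def prec_eq_cone_rel(1-4) prec_eq_cone_rel(5-7)[abs_def]
      image_Un range_eq[of top_pos] range_eq[of "\<lambda>i. deg_then 1 (top_pos i)"]
      range_eq[of "\<lambda>i. deg_then (- 1) (top_pos i)"] image_insert image_empty ..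
qed

lemma preorder_iff_listed:
  fixes r :: "'k::field polyring rel"
  assumes "r \<subseteq> monomials \<times> monomials"
  shows "monomial_preorder r \<and> inc_compatible r \<longleftrightarrow>
     trivial_preorder r \<or> r \<in> listed_preorders \<or> r\<inverse> \<in> listed_preorders"
proof -
  have trivial: "trivial_preorder r \<longleftrightarrow> r = cone_rel (\<lambda>_. False)"
    using assms by (auto simp: trivial_preorder_def incomparable_def cone_rel_def)
  have conv: "r\<inverse> = cone_rel P \<longleftrightarrow> r = cone_rel (\<lambda>v. P (- v))" for P
    by (metis converse_cone_rel converse_converse)
  have neg: "inc_cone (\<lambda>v. P (- v))" if "P \<in> listed_cones" for P
    using that by (intro inc_cone_uminus inc_cone_listed)
  have "(\<exists>P. inc_cone P \<and> r = cone_rel P) \<longleftrightarrow>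
      r = cone_rel (\<lambda>_. False) \<or> (\<exists>P\<in>listed_cones. r = cone_rel P) \<or> (\<exists>P\<in>listed_cones. r = cone_rel (\<lambda>v. P (- v)))"
    (is "?L \<longleftrightarrow> ?R")
  proof
    assume ?L
    then obtain P where P: "inc_cone P" "r = cone_rel P" by blast
    from inc_cone.classify[OF P(1)] show ?R
    proof (elim disjE)
      assume "(\<lambda>v. P (- v)) \<in> listed_cones"
      moreover have "r = cone_rel (\<lambda>v. (\<lambda>v. P (- v)) (- v))" by (simp add: P(2))
      ultimately show ?R by (intro disjI2 bexI[of _ "\<lambda>v. P (- v)"])
    qed (simp_all add: P(2), blast)
  next
    assume ?R
    then show ?L by (elim disjE bexE) (auto intro: inc_cone_False inc_cone_listed neg)
  qed
  then show ?thesis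
    unfolding cone_rel_iff_preorder trivial listed_preorders_eq image_iff conv .
qed

section \<open>Term orders\<close>

text \<open>The cones of the six term orders, in the order of the theorem. Thresholds are shifted by
  one, and the cones with \<open>s = - 1\<close> enter through their inverses.\<close>

definition total_cones :: "(int poly \<Rightarrow> bool) set" where
  "total_cones = {bottom_pos, deg_then 1 bottom_pos, \<lambda>v. deg_then (- 1) bottom_pos (- v),
     top_pos 0, deg_then 1 (top_pos 1), \<lambda>v. deg_then (- 1) (top_pos 1) (- v)}"

lemma top_pos_total:
  assumes "v \<noteq> 0" shows "top_pos 0 v \<or> top_pos 0 (- v)"
  using assms by (cases v rule: top_pos_cases[where i = 0]) (auto simp: poly_eq_iff)

text \<open>An element of degree zero cannot be supported on index 0 alone. Hence, after comparing
  degrees, thresholds 0 and 1 give the same order.\<close>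

lemma top_pos_0_1:
  assumes "poly v 1 = 0" shows "top_pos 0 v = top_pos 1 v"
proof -
  have "coeff v 0 = 0" if "\<And>j. j > 0 \<Longrightarrow> coeff v j = 0"
  proof -
    have "(\<Sum>k\<le>degree v. coeff v k) = (\<Sum>k\<in>{0}. coeff v k)"
      using that by (intro sum.mono_neutral_right) auto
    then show ?thesis using assms poly_1_eq_sum[OF order.refl, of v] by simp
  qed
  then show ?thesis unfolding top_pos_def
    by (metis One_nat_def Suc_leI le0 less_irrefl neq0_conv)
qed

lemma bottom_pos_total:
  assumes "v \<noteq> 0" shows "bottom_pos v \<or> bottom_pos (- v)"
  using assms by (cases v rule: bottom_pos_cases) auto

lemma total_cones_facts:
  assumes "P \<in> total_cones"
  shows "inc_cone P" "v \<noteq> 0 \<Longrightarrow> P v \<or> P (- v)" "P (e k)"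
proof -
  have "inc_cone (deg_then s bottom_pos)" "inc_cone (deg_then s (top_pos 1))" if "s \<noteq> 0" for s
    using that by (auto intro: inc_cone_deg_then inc_cone_bottom_pos inc_cone_top_pos)
  from this[of 1] this[of "- 1"] show "inc_cone P"
    using assms inc_cone_uminus unfolding total_cones_def
    by (auto intro: inc_cone_bottom_pos inc_cone_top_pos)
  have top: "top_pos 0 (e k)" unfolding top_pos_def by (intro exI[of _ k]) auto
  have bottom: "bottom_pos (e k)" unfolding bottom_pos_def by (intro exI[of _ k]) auto
  show "P (e k)"
    using assms top bottom by (auto simp: total_cones_def deg_then_def poly_monom)
  assume "v \<noteq> 0"
  have "top_pos 1 v \<or> top_pos 1 (- v)" if "poly v 1 = 0"
    using top_pos_total[OF \<open>v \<noteq> 0\<close>] top_pos_0_1[of v] top_pos_0_1[of "- v"] that by auto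
  then show "P v \<or> P (- v)"
    using assms top_pos_total[OF \<open>v \<noteq> 0\<close>] bottom_pos_total[OF \<open>v \<noteq> 0\<close>]
    by (auto simp: total_cones_def deg_then_def)
qed

text \<open>Positive basis vectors exclude the wrong orientations and force threshold 0 for a pure
  \<open>top_pos\<close>. Comparability of \<open>e 1 - e 0\<close> with 0 excludes the bare degree
  order and bounds the threshold after a degree comparison by 1.\<close>

lemma total_conesI:
  assumes "inc_cone P" and total: "\<And>v. v \<noteq> 0 \<Longrightarrow> P v \<or> P (- v)" and pos: "\<And>k. P (e k)"
  shows "P \<in> total_cones"
proof -
  have ne: "e 1 - e 0 \<noteq> 0" "e 0 \<noteq> 0" by (auto simp: poly_eq_iff)
  have top_diff: "top_pos i (e 1 - e 0) \<Longrightarrow> i \<le> 1" "top_pos i (- (e 1 - e 0)) \<Longrightarrow> i \<le> 1"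
    "top_pos i (e 0) \<Longrightarrow> i = 0" for i
    by (auto simp: top_pos_def split: if_splits)
  have bottom_neg: "\<not> bottom_pos (- e 0)" by (auto simp: bottom_pos_def split: if_splits)
  have top_neg: "\<not> top_pos i (- e i)" for i by (auto simp: top_pos_def split: if_splits)
  have top_eq: "deg_then s (top_pos i) = deg_then s (top_pos 1)" if "i \<le> 1" for s i
  proof (cases "i = 0")
    case False
    then have "i = 1" using that by simp
    then show ?thesis by simp
  qed (auto simp: deg_then_def fun_eq_iff top_pos_0_1)
  from inc_cone.classify[OF assms(1)] consider "P = (\<lambda>_. False)" | "P \<in> listed_cones" | "(\<lambda>v. P (- v)) \<in> listed_cones"
    by blast
  then show ?thesis
  proof cases
    case 1
    then show ?thesis using pos by simp
  next
    case 2
    then consider "P = deg_then 1 (\<lambda>_. False)" | "P = deg_then (- 1) bottom_pos"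
      | i where "P = deg_then (- 1) (top_pos i)" | "P \<in> {bottom_pos, deg_then 1 bottom_pos}"
      | i where "P = top_pos i" | i where "P = deg_then 1 (top_pos i)"
      by (auto simp: listed_cones_def)
    then show ?thesis
    proof cases
      case 1
      then show ?thesis using total[OF ne(1)] by (simp add: deg_then_def poly_monom)
    next
      case 5
      then show ?thesis using pos[of 0] top_diff(3) by (auto simp: total_cones_def)
    next
      case (6 i)
      then have "i \<le> 1" using total[OF ne(1)] top_diff by (auto simp: deg_then_def poly_monom)
      show ?thesis unfolding total_cones_def 6 top_eq[OF \<open>i \<le> 1\<close>] by blast
    qed (use pos[of 0] in \<open>auto simp: total_cones_def deg_then_def poly_monom\<close>)
  next
    case 3
    define Q where "Q = (\<lambda>v. P (- v))"
    have P: "P = (\<lambda>v. Q (- v))" by (simp add: Q_def)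
    from 3 consider "Q = deg_then 1 (\<lambda>_. False)" | "Q = deg_then 1 bottom_pos"
      | i where "Q = deg_then 1 (top_pos i)" | "Q = bottom_pos" | i where "Q = top_pos i"
      | "Q = deg_then (- 1) bottom_pos" | i where "Q = deg_then (- 1) (top_pos i)"
      unfolding Q_def[symmetric] by (auto simp: listed_cones_def)
    then show ?thesis
    proof cases
      case 4
      then show ?thesis using pos[of 0] bottom_neg by (simp add: P)
    next
      case (5 i)
      then show ?thesis using pos[of i] top_neg by (simp add: P)
    next
      case 6
      then show ?thesis by (simp add: P total_cones_def)
    next
      case (7 i)
      then have "i \<le> 1" using total[OF ne(1)] top_diff[of i] by (auto simp: deg_then_def poly_monom P)
      show ?thesis unfolding P total_cones_def 7 top_eq[OF \<open>i \<le> 1\<close>] by blast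
    qed (use pos[of 0] in \<open>auto simp: P deg_then_def poly_monom\<close>)
  qed
qed

section \<open>Telling the six cones apart\<close>

text \<open>Test vectors on the first three indices; the rules below turn cone membership into sign
  conditions on the entries.\<close>

definition vec3 :: "int \<Rightarrow> int \<Rightarrow> int \<Rightarrow> int poly" where
  "vec3 a b c = [:a, b, c:]"

lemma coeff_vec3: "coeff (vec3 a b c) k = (if k = 0 then a else if k = 1 then b else if k = 2 then c else 0)"
  by (auto simp: vec3_def coeff_pCons split: nat.splits)

lemma top_pos_vec3:
  "top_pos i (vec3 a b c) \<longleftrightarrow> (i \<le> 2 \<and> c > 0) \<or> (c = 0 \<and> i \<le> 1 \<and> b > 0) \<or> (c = 0 \<and> b = 0 \<and> i = 0 \<and> a > 0)"
    (is "?L \<longleftrightarrow> ?R")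
proof
  assume ?L
  then obtain k where k: "k \<ge> i" "coeff (vec3 a b c) k > 0" "\<And>j. j > k \<Longrightarrow> coeff (vec3 a b c) j = 0"
    by (auto simp: top_pos_def)
  from k(2) have "k = 0 \<or> k = 1 \<or> k = 2" by (auto simp: coeff_vec3 split: if_splits)
  then show ?R using k(1,2) k(3)[of 1] k(3)[of 2] by (auto simp: coeff_vec3)
next
  assume ?R
  then consider "i \<le> 2" "c > 0" | "c = 0" "i \<le> 1" "b > 0" | "c = 0" "b = 0" "i = 0" "a > 0" by blast
  then show ?L
    unfolding top_pos_def coeff_vec3
    by cases (rule exI[of _ 2] exI[of _ 1] exI[of _ 0]; (auto; fail))+
qed

lemma bottom_pos_vec3:
  "bottom_pos (vec3 a b c) \<longleftrightarrow> a > 0 \<or> (a = 0 \<and> b > 0) \<or> (a = 0 \<and> b = 0 \<and> c > 0)"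
    (is "?L \<longleftrightarrow> ?R")
proof
  assume ?L
  then obtain k where k: "coeff (vec3 a b c) k > 0" "\<And>j. j < k \<Longrightarrow> coeff (vec3 a b c) j = 0"
    by (auto simp: bottom_pos_def)
  from k(1) have "k = 0 \<or> k = 1 \<or> k = 2" by (auto simp: coeff_vec3 split: if_splits)
  then show ?R using k(1) k(2)[of 0] k(2)[of 1] by (auto simp: coeff_vec3)
next
  assume ?R
  then consider "a > 0" | "a = 0" "b > 0" | "a = 0" "b = 0" "c > 0" by blast
  then show ?L
    unfolding bottom_pos_def coeff_vec3
    by cases (rule exI[of _ 2] exI[of _ 1] exI[of _ 0]; (auto; fail))+
qed

lemma deg_then_vec3: "deg_then s Q (vec3 a b c) \<longleftrightarrow> s * (a + b + c) > 0 \<or> (a + b + c = 0 \<and> Q (vec3 a b c))"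
  by (simp add: deg_then_def vec3_def algebra_simps)

lemma uminus_vec3: "- vec3 a b c = vec3 (- a) (- b) (- c)"
  by (simp add: vec3_def)

lemma card_total_cones: "card total_cones = 6"
proof (rule antisym)
  \<comment> \<open>The signs of these four vectors tell the six cones apart.\<close>
  define test where
    "test P = (P (vec3 1 (- 1) 0), P (vec3 (- 1) 2 0), P (vec3 2 (- 1) 0), P (vec3 1 (- 2) 1))"
    for P :: "int poly \<Rightarrow> bool"
  have "test ` total_cones =
    {(True, False, True, True), (True, True, True, True), (False, True, True, False),
     (False, True, False, True), (False, True, True, True), (True, True, True, False)}"
    unfolding total_cones_def image_insert image_empty test_def
    by (simp add: top_pos_vec3 bottom_pos_vec3 deg_then_vec3 uminus_vec3)
  moreover have "finite total_cones" by (simp add: total_cones_def)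
  then have "card (test ` total_cones) \<le> card total_cones" by (rule card_image_le)
  ultimately show "6 \<le> card total_cones" by simp
  show "card total_cones \<le> 6" by (simp add: total_cones_def card_insert_if)
qed

section \<open>Term orders and their strict parts\<close>

lemma cone_rel_term_order:
  assumes "P \<in> total_cones"
  shows "term_order (cone_rel P \<union> Id_on monomials :: 'k::field polyring rel)" (is "term_order ?r")
    and "inc_compatible (cone_rel P \<union> Id_on monomials :: 'k polyring rel)"
proof -
  interpret inc_cone P using total_cones_facts(1)[OF assms] .
  have pre: "monomial_preorder (cone_rel P :: 'k polyring rel)" by (intro monomial_preorder_cone_rel cone_axioms)
  have one: "(1, f) \<in> ?r" if f_in: "f \<in> monomials" for f
  proof -
    obtain a where f: "f = xmon a" using f_in by (auto simp: monomials_def)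
    \<comment> \<open>Exponents are non-negative combinations of the positive \<open>e j\<close>,
      hence not negative; totality then puts 1 below every other monomial.\<close>
    have "\<not> P (- (\<Sum>j\<le>degree (expo_poly a). of_int (coeff (expo_poly a) j) * e j))"
    proof (intro nonneg_sum nonneg_scale asym total_cones_facts(3)[OF assms])
      fix k
      show "0 \<le> coeff (expo_poly a) k" by (cases k rule: idx_surj) simp
    qed
    then have "\<not> P (- expo_poly a)" by (simp flip: sum_unit_vec[OF order.refl])
    then have "a = 0 \<or> P (expo_poly a)"
      using total_cones_facts(2)[OF assms, of "expo_poly a"] by (metis expo_poly_0 expo_poly_eq_iff)
    then show ?thesis by (auto simp: f simp flip: xmon_0)
  qed
  have "total_on monomials ?r"
  proof (rule total_onI)
    fix f g :: "'k polyring" assume "f \<in> monomials" "g \<in> monomials" "f \<noteq> g"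
    then obtain a b where "f = xmon a" "g = xmon b" "a \<noteq> b" by (auto simp: monomials_def)
    then show "(f, g) \<in> ?r \<or> (g, f) \<in> ?r"
      using total_cones_facts(2)[OF assms, of "expo_poly b - expo_poly a"] by auto
  qed
  moreover have "antisym ?r"
    by (auto simp: antisym_def cone_rel_def dest: asym)
  moreover have "trans ?r"
  proof -
    have "trans (cone_rel P :: 'k polyring rel)" using pre by (simp add: monomial_preorder_def)
    then show ?thesis unfolding trans_def Id_on_def by blast
  qed
  moreover have "refl_on monomials ?r" "?r \<subseteq> monomials \<times> monomials"
    using cone_rel_subset by (auto simp: refl_on_def Id_on_def)
  ultimately have "linear_order_on monomials ?r"
    by (simp add: linear_order_on_def partial_order_on_def preorder_on_def)
  moreover have "(h * f, h * g) \<in> ?r" if "f \<in> monomials" "g \<in> monomials" "h \<in> monomials" "(f, g) \<in> ?r" for f g h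
  proof (cases "f = g")
    case True
    have "h * g \<in> monomials" using that by (auto simp: monomials_def simp flip: xmon_add)
    then show ?thesis using True by (auto simp: Id_on_def)
  next
    case False
    then show ?thesis using pre that unfolding monomial_preorder_def by blast
  qed
  ultimately show "term_order ?r" using one by (auto simp: term_order_def)
  show "inc_compatible ?r"
    using inc_compatible_cone_rel[OF total_cones_facts(1)[OF assms]]
    by (auto simp: inc_compatible_def inc_act_eq)
qed

text \<open>Cancellation follows from totality: the opposite comparison, multiplied back, would
  contradict antisymmetry. Incomparability in the strict part is equality, hence transitive.\<close>

lemma term_order_strict_part:
  fixes r :: "'k::field polyring rel"
  assumes "term_order r" "inc_compatible r"
  shows "monomial_preorder (r - Id)" "inc_compatible (r - Id)"
proof -
  have sub: "r \<subseteq> monomials \<times> monomials" and "trans r" "antisym r" and tot: "total_on monomials r"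
    and refl: "refl_on monomials r"
    using assms(1) by (auto simp: term_order_def linear_order_on_def partial_order_on_def preorder_on_def)
  have mult: "(xmon a, xmon b) \<in> r \<Longrightarrow> (xmon (c + a), xmon (c + b)) \<in> r" for a b c
    using assms(1) by (auto simp: term_order_def xmon_add)
  have total: "(xmon a, xmon b) \<in> r \<or> (xmon b, xmon a) \<in> r \<or> a = b" for a b
    using tot[unfolded total_on_def, rule_format, of "xmon a" "xmon b"] by auto
  have canc: "(xmon a, xmon b) \<in> r" if "(xmon (c + a), xmon (c + b)) \<in> r" for a b c
  proof (rule ccontr)
    assume "\<not> ?thesis"
    moreover from this have "a \<noteq> b" using refl by (auto simp: refl_on_def)
    ultimately have "(xmon b, xmon a) \<in> r" using total[of a b] by blast
    from mult[OF this] that \<open>antisym r\<close> have "xmon (c + a) = (xmon (c + b) :: 'k polyring)" by (auto dest: antisymD)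
    then show False using \<open>a \<noteq> b\<close> by simp
  qed
  have inc: "incomparable (r - Id) (xmon a) (xmon b) \<longleftrightarrow> a = b" for a b
    using total[of a b] by (auto simp: incomparable_def)
  have mult_iff: "(xmon (c + a), xmon (c + b)) \<in> r \<longleftrightarrow> (xmon a, xmon b) \<in> r" for a b c
    using mult canc by blast
  show "monomial_preorder (r - Id)"
    unfolding monomial_preorder_def
  proof (intro conjI)
    show "trans (r - Id)" using \<open>trans r\<close> \<open>antisym r\<close> by (rule trans_diff_Id)
  qed (use sub in \<open>auto simp: irrefl_def monomials_def inc mult_iff simp flip: xmon_add\<close>)
  show "inc_compatible (r - Id)"
    using assms(2) push_expo_eq_iff by (auto simp: inc_compatible_def inc_act_eq)
qed

lemma term_order_iff:
  fixes r :: "'k::field polyring rel"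
  shows "term_order r \<and> inc_compatible r \<longleftrightarrow> (\<exists>P\<in>total_cones. r = cone_rel P \<union> Id_on monomials)"
proof
  assume r: "term_order r \<and> inc_compatible r"
  then obtain P where P: "inc_cone P" "r - Id = cone_rel P"
    using term_order_strict_part cone_rel_iff_preorder by metis
  have sub: "r \<subseteq> monomials \<times> monomials" and tot: "total_on monomials r" and refl: "refl_on monomials r"
    using r by (auto simp: term_order_def linear_order_on_def partial_order_on_def preorder_on_def)
  have P_iff: "P (expo_poly b - expo_poly a) \<longleftrightarrow> (xmon a, xmon b) \<in> r \<and> a \<noteq> b" for a b
    using P(2) by (metis DiffE DiffI pair_in_Id_conv xmon_cone_rel_iff xmon_eq_iff)
  have "P \<in> total_cones"
  proof (rule total_conesI[OF P(1)])
    fix v :: "int poly" assume "v \<noteq> 0"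
    obtain a b where v: "v = expo_poly b - expo_poly a" by (rule expo_poly_diff_surj)
    have neg: "- v = expo_poly a - expo_poly b" by (simp add: v)
    have "a \<noteq> b" using \<open>v \<noteq> 0\<close> v by auto
    then show "P v \<or> P (- v)"
      using tot[unfolded total_on_def, rule_format, of "xmon a" "xmon b"] unfolding neg unfolding v P_iff by auto
  next
    fix k
    obtain j where j: "k = idx j" by (rule idx_surj)
    have "(xmon 0, xmon (Poly_Mapping.single j 1)) \<in> r"
      using r by (auto simp: term_order_def xmon_0)
    moreover have "Poly_Mapping.single j (1 :: nat) \<noteq> 0"
      by (metis lookup_single_eq lookup_zero one_neq_zero)
    ultimately show "P (e k)"
      using P_iff[of "Poly_Mapping.single j 1" 0] by (simp add: expo_poly_single j)
  qed
  moreover have "r = cone_rel P \<union> Id_on monomials"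
    using sub refl P(2) by (auto simp: refl_on_def Id_on_def)
  ultimately show "\<exists>P\<in>total_cones. r = cone_rel P \<union> Id_on monomials" by blast
qed (use cone_rel_term_order in auto)

lemma cone_rel_strict_part: "P \<in> total_cones \<Longrightarrow> (cone_rel P \<union> Id_on monomials) - Id = cone_rel P"
  using cone.irrefl[OF inc_cone.axioms(1)[OF total_cones_facts(1)], of P] by (auto simp: cone_rel_def)

theorem theorem4p28:
  shows "(\<forall>r :: 'k::field polyring rel. r \<subseteq> monomials \<times> monomials \<longrightarrow>
            (monomial_preorder r \<and> inc_compatible r \<longleftrightarrow>
             trivial_preorder r \<or> r \<in> listed_preorders \<or> r\<inverse> \<in> listed_preorders))
       \<and> {r - Id | r :: 'k polyring rel. term_order r \<and> inc_compatible r} =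
            {prec_min, prec_d_min, prec_rd_min\<inverse>,
             prec_max num.One, prec_d_max (num.Bit0 num.One), (prec_rd_max (num.Bit0 num.One))\<inverse>}
       \<and> card {r :: 'k polyring rel. term_order r \<and> inc_compatible r} = 6"
proof (intro conjI allI impI)
  let ?c = "\<lambda>P. cone_rel P \<union> Id_on monomials :: 'k polyring rel"
  have orders: "{r :: 'k polyring rel. term_order r \<and> inc_compatible r} = ?c ` total_cones"
    unfolding term_order_iff by blast
  have "{r - Id | r :: 'k polyring rel. term_order r \<and> inc_compatible r} = (\<lambda>r. r - Id) ` ?c ` total_cones"
    unfolding orders[symmetric] by blast
  also have "\<dots> = cone_rel ` total_cones"
    unfolding image_image by (intro image_cong refl cone_rel_strict_part)
  also have "\<dots> = {prec_min, prec_d_min, prec_rd_min\<inverse>,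
      prec_max num.One, prec_d_max (num.Bit0 num.One), (prec_rd_max (num.Bit0 num.One))\<inverse>}"
    unfolding prec_eq_cone_rel converse_cone_rel by (simp add: total_cones_def idx_def)
  finally show "{r - Id | r :: 'k polyring rel. term_order r \<and> inc_compatible r} = \<dots>" .
  \<comment> \<open>Removing the diagonal recovers \<open>cone_rel P\<close>, which determines
    \<open>P\<close>; so counting the orders is counting the cones.\<close>
  have "inj_on ?c total_cones"
    by (rule inj_onI) (metis cone_rel_strict_part cone_rel_inject)
  then show "card {r :: 'k polyring rel. term_order r \<and> inc_compatible r} = 6"
    unfolding orders by (simp add: card_image card_total_cones)
qed (rule preorder_iff_listed)

end
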